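(* Let $Q:\mathbf{T}\to\mathbb{R}$ be a $C^{3}$ potential such that $Q''\ge\rho-\frac12$ on $\mathbf{T}$ for some $\rho>0$. Then for every smooth probability measure $\mu$ on $\mathbf{T}$, $$E_Q(\mu)-E_Q(\mu_Q)\le\frac{1}{2\rho}\,I_Q(\mu).$$
   Context: $\mathbf{T}$ is the unit circle in $\mathbb{C}$ and $\alpha$ is the normalized (probability) Haar measure on $\mathbf{T}$. A measure on $\mathbf{T}$ is called smooth if it has a smooth density with respect to $\alpha$. For a differentiable function $\phi$ on $\mathbf{T}$, $\phi'(z)=\frac{d}{dt}\big|_{t=0}\phi(ze^{it})$, and higher derivatives are defined by iterating. For a continuous $Q:\mathbf{T}\to\mathbb{R}$ (a potential) and a probability measure $\mu$ on $\mathbf{T}$, $E_Q(\mu)=\int Q\,d\mu-\iint\log|x-y|\,\mu(dx)\mu(dy)$; $\mu_Q$ denotes the (unique) minimizer of $E_Q$ over probability measures on $\mathbf{T}$. For a smooth probability measure $\mu$ on $\mathbf{T}$, with density $m$ with respect to $\alpha$, define $H\mu:\mathbf{T}\to\mathbb{R}$ by the principal value integral $$H\mu(e^{ix})=\mathrm{p.v.}\int\cot\Big(\frac{x-y}{2}\Big)\,m(e^{iy})\,\frac{dy}{2\pi}$$ over an interval of length $2\pi$, and $$I_Q(\mu)=\int(H\mu-Q')^{2}\,d\mu-\Big(\int Q'\,d\mu\Big)^{2}.$$ *)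

theory Defs
  imports "HOL-Probability.Probability"
begin

abbreviation unit_circle :: "complex set" where
  "unit_circle \<equiv> sphere 0 1"

abbreviation circle_borel :: "complex measure" where
  "circle_borel \<equiv> restrict_space borel unit_circle"

definition circle_prob :: "complex measure \<Rightarrow> bool" where
  "circle_prob \<mu> \<longleftrightarrow> prob_space \<mu> \<and> sets \<mu> = sets circle_borel"

text \<open>The normalized Haar measure: the law of a uniformly distributed angle. The lemmas
  \<open>circle_prob_haar\<close> and \<open>circle_haar_rotation\<close> below characterize it.\<close>

definition circle_haar :: "complex measure" where
  "circle_haar = distr (uniform_measure lborel {0..<2 * pi}) circle_borel cis"

definition circle_deriv :: "(complex \<Rightarrow> real) \<Rightarrow> complex \<Rightarrow> real" where
  "circle_deriv \<phi> z = deriv (\<lambda>t. \<phi> (z * cis t)) 0"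

definition circle_Ck :: "nat \<Rightarrow> (complex \<Rightarrow> real) \<Rightarrow> bool" where
  "circle_Ck k \<phi> \<longleftrightarrow>
     (\<forall>j<k. \<forall>z\<in>unit_circle. (\<lambda>t. (circle_deriv ^^ j) \<phi> (z * cis t)) differentiable (at 0)) \<and>
     continuous_on unit_circle ((circle_deriv ^^ k) \<phi>)"

definition circle_smooth :: "(complex \<Rightarrow> real) \<Rightarrow> bool" where
  "circle_smooth \<phi> \<longleftrightarrow> (\<forall>k. circle_Ck k \<phi>)"

definition smooth_density :: "complex measure \<Rightarrow> (complex \<Rightarrow> real) \<Rightarrow> bool" where
  "smooth_density \<mu> m \<longleftrightarrow>
     circle_smooth m \<and> (\<forall>z\<in>unit_circle. 0 \<le> m z) \<and> \<mu> = density circle_haar (\<lambda>z. ennreal (m z))"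

definition smooth_circle_measure :: "complex measure \<Rightarrow> bool" where
  "smooth_circle_measure \<mu> \<longleftrightarrow> (\<exists>m. smooth_density \<mu> m)"

text \<open>A smooth density is continuous, hence determined by the measure at every point of the
  circle; the choice only concerns irrelevant values off the circle.\<close>

definition circle_density :: "complex measure \<Rightarrow> complex \<Rightarrow> real" where
  "circle_density \<mu> = (SOME m. smooth_density \<mu> m)"

definition ext_integral :: "'a measure \<Rightarrow> ('a \<Rightarrow> ereal) \<Rightarrow> ereal" where
  "ext_integral M f =
     enn2ereal (\<integral>\<^sup>+x. e2ennreal (f x) \<partial>M) - enn2ereal (\<integral>\<^sup>+x. e2ennreal (- f x) \<partial>M)"

text \<open>The diagonal needs the explicit value \<open>-\<infinity>\<close> because \<^term>\<open>ln (0::real)\<close> is \<open>0\<close>.\<close>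

definition log_dist :: "complex \<Rightarrow> complex \<Rightarrow> ereal" where
  "log_dist x y = (if x = y then - \<infinity> else ereal (ln (norm (x - y))))"

text \<open>On the circle \<^const>\<open>log_dist\<close> is bounded above, so for a probability measure the energy
  is a well-defined element of \<open>(-\<infinity>, \<infinity>]\<close>.\<close>

definition log_energy :: "(complex \<Rightarrow> real) \<Rightarrow> complex measure \<Rightarrow> ereal" where
  "log_energy Q \<mu> =
     ereal (\<integral>x. Q x \<partial>\<mu>) - ext_integral (\<mu> \<Otimes>\<^sub>M \<mu>) (\<lambda>(x, y). log_dist x y)"

definition energy_minimizer :: "(complex \<Rightarrow> real) \<Rightarrow> complex measure \<Rightarrow> bool" where
  "energy_minimizer Q \<nu> \<longleftrightarrow>
     circle_prob \<nu> \<and> (\<forall>\<mu>. circle_prob \<mu> \<longrightarrow> log_energy Q \<nu> \<le> log_energy Q \<mu>)"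

definition circle_hilbert :: "complex measure \<Rightarrow> complex \<Rightarrow> real" where
  "circle_hilbert \<mu> z =
     (let x = Arg z in
      Lim (at_right 0) (\<lambda>\<epsilon>. LINT y:{y. \<epsilon> < \<bar>x - y\<bar> \<and> \<bar>x - y\<bar> \<le> pi}|lborel.
        cot ((x - y) / 2) * circle_density \<mu> (cis y) / (2 * pi)))"

definition circle_fisher :: "(complex \<Rightarrow> real) \<Rightarrow> complex measure \<Rightarrow> real" where
  "circle_fisher Q \<mu> =
     (\<integral>z. (circle_hilbert \<mu> z - circle_deriv Q z)\<^sup>2 \<partial>\<mu>) - (\<integral>z. circle_deriv Q z \<partial>\<mu>)\<^sup>2"

lemma cis_measurable_circle: "cis \<in> borel \<rightarrow>\<^sub>M circle_borel"
  by (rule measurable_restrict_space2)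
     (auto intro!: borel_measurable_continuous_onI continuous_intros)

lemma prob_uniform_angle: "prob_space (uniform_measure lborel {0..<2 * pi})"
  by (rule prob_space_uniform_measure) (simp_all add: emeasure_lborel_Ico)

lemma circle_prob_haar: "circle_prob circle_haar"
proof -
  have "cis \<in> uniform_measure lborel {0..<2 * pi} \<rightarrow>\<^sub>M circle_borel"
    using cis_measurable_circle by (simp cong: measurable_cong_sets)
  then show ?thesis
    unfolding circle_prob_def circle_haar_def
    by (simp add: prob_space.prob_space_distr[OF prob_uniform_angle])
qed

lemma nn_integral_circle_haar:
  assumes "f \<in> borel_measurable circle_borel"
  shows "(\<integral>\<^sup>+z. f z \<partial>circle_haar) = (\<integral>\<^sup>+t\<in>{0..<2 * pi}. f (cis t) \<partial>lborel) / ennreal (2 * pi)"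
proof -
  have m: "cis \<in> uniform_measure lborel {0..<2 * pi} \<rightarrow>\<^sub>M circle_borel"
    using cis_measurable_circle by (simp cong: measurable_cong_sets)
  have f: "(\<lambda>t. f (cis t)) \<in> borel_measurable lborel"
    using measurable_compose[OF cis_measurable_circle assms] by simp
  show ?thesis
    unfolding circle_haar_def
    by (subst nn_integral_distr[OF m])
       (simp_all add: assms nn_integral_uniform_measure[OF f] emeasure_lborel_Ico)
qed

lemma nn_integral_lborel_shift:
  fixes h :: "real \<Rightarrow> ennreal"
  assumes [measurable]: "h \<in> borel_measurable borel"
  shows "(\<integral>\<^sup>+t. h (s + t) \<partial>lborel) = (\<integral>\<^sup>+t. h t \<partial>lborel)"
  by (subst (2) lborel_distr_plus[of s, symmetric]) (simp add: nn_integral_distr)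

lemma circle_haar_rotation:
  assumes "w \<in> unit_circle"
  shows "distr circle_haar circle_haar (\<lambda>z. w * z) = circle_haar"
proof -
  define s where "s = Arg2pi w"
  have s: "0 \<le> s" "s < 2 * pi" and w: "w = cis s"
    using assms Arg2pi_eq[of w] by (auto simp: s_def Arg2pi cis_conv_exp)
  have sets: "sets circle_haar = sets circle_borel"
    using circle_prob_haar by (simp add: circle_prob_def)
  have rot: "(\<lambda>z. w * z) \<in> circle_borel \<rightarrow>\<^sub>M circle_borel"
    using assms by (intro measurable_restrict_space2 measurable_restrict_space1)
                   (auto simp: space_restrict_space norm_mult)
  have rot': "(\<lambda>z. w * z) \<in> circle_haar \<rightarrow>\<^sub>M circle_haar"
    using rot sets by (simp cong: measurable_cong_sets)
  show ?thesis
  proof (rule measure_eqI)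
    show "sets (distr circle_haar circle_haar (\<lambda>z. w * z)) = sets circle_haar" by simp
    fix A assume "A \<in> sets (distr circle_haar circle_haar (\<lambda>z. w * z))"
    then have A: "A \<in> sets circle_haar" by simp
    define f :: "complex \<Rightarrow> ennreal" where "f = indicator A"
    have f: "f \<in> borel_measurable circle_borel"
      using A sets by (simp add: f_def)
    have [measurable]: "(\<lambda>t. f (cis t)) \<in> borel_measurable borel"
      using measurable_compose[OF cis_measurable_circle f] .
    have f': "(\<lambda>z. f (w * z)) \<in> borel_measurable circle_borel"
      using measurable_compose[OF rot f] .
    have per: "f (cis (2 * pi + t)) = f (cis t)" for t
      by (simp add: cis_mult[symmetric])
    have "(\<integral>\<^sup>+t\<in>{0..<2 * pi}. f (w * cis t) \<partial>lborel)
        = (\<integral>\<^sup>+t. f (cis (s + t)) * indicator {s..<s + 2 * pi} (s + t) \<partial>lborel)"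
      by (intro nn_integral_cong) (auto simp: w cis_mult indicator_def)
    also have "\<dots> = (\<integral>\<^sup>+t. f (cis t) * indicator {s..<s + 2 * pi} t \<partial>lborel)"
      by (rule nn_integral_lborel_shift[of "\<lambda>t. f (cis t) * indicator {s..<s + 2 * pi} t"]) simp
    also have "\<dots> = (\<integral>\<^sup>+t. (f (cis t) * indicator {s..<2 * pi} t
                        + f (cis t) * indicator {2 * pi..<s + 2 * pi} t) \<partial>lborel)"
      using s by (intro nn_integral_cong) (auto simp: indicator_def)
    also have "\<dots> = (\<integral>\<^sup>+t. f (cis t) * indicator {s..<2 * pi} t \<partial>lborel)
                   + (\<integral>\<^sup>+t. f (cis t) * indicator {2 * pi..<s + 2 * pi} t \<partial>lborel)"
      by (rule nn_integral_add) simp_all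
    also have "(\<integral>\<^sup>+t. f (cis t) * indicator {2 * pi..<s + 2 * pi} t \<partial>lborel)
             = (\<integral>\<^sup>+t. f (cis (2 * pi + t)) * indicator {2 * pi..<s + 2 * pi} (2 * pi + t) \<partial>lborel)"
      by (rule nn_integral_lborel_shift
            [of "\<lambda>t. f (cis t) * indicator {2 * pi..<s + 2 * pi} t", symmetric]) simp
    also have "\<dots> = (\<integral>\<^sup>+t. f (cis t) * indicator {0..<s} t \<partial>lborel)"
      by (intro nn_integral_cong) (auto simp: per indicator_def)
    also have "(\<integral>\<^sup>+t. f (cis t) * indicator {s..<2 * pi} t \<partial>lborel)
             + (\<integral>\<^sup>+t. f (cis t) * indicator {0..<s} t \<partial>lborel)
             = (\<integral>\<^sup>+t. (f (cis t) * indicator {s..<2 * pi} t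
                        + f (cis t) * indicator {0..<s} t) \<partial>lborel)"
      by (rule nn_integral_add[symmetric]) simp_all
    also have "\<dots> = (\<integral>\<^sup>+t\<in>{0..<2 * pi}. f (cis t) \<partial>lborel)"
      using s by (intro nn_integral_cong) (auto simp: indicator_def)
    finally have "(\<integral>\<^sup>+z. f (w * z) \<partial>circle_haar) = (\<integral>\<^sup>+z. f z \<partial>circle_haar)"
      by (simp add: nn_integral_circle_haar[OF f] nn_integral_circle_haar[OF f'])
    moreover have "emeasure (distr circle_haar circle_haar (\<lambda>z. w * z)) A
        = (\<integral>\<^sup>+z. f z \<partial>distr circle_haar circle_haar (\<lambda>z. w * z))"
      using A by (simp add: f_def)
    moreover have "\<dots> = (\<integral>\<^sup>+z. f (w * z) \<partial>circle_haar)"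
      using f sets by (intro nn_integral_distr[OF rot']) (simp cong: measurable_cong_sets)
    ultimately show "emeasure (distr circle_haar circle_haar (\<lambda>z. w * z)) A = emeasure circle_haar A"
      using A by (simp add: f_def)
  qed
qed

end

theory Submission
  imports Defs
begin

text \<open>
  The proof is by mass transport. Parametrize \<open>\<mu>\<close> and \<open>\<mu>\<^sub>Q\<close> by nondecreasing angle functions \<open>a\<close>
  and \<open>b\<close> on the unit interval and put \<open>u = b - a\<close>. Since \<open>- ln (2 * sin (s / 2))\<close> has second
  derivative at least \<open>1 / 4\<close> on \<open>{0<..<2 * pi}\<close>, the interaction energy of \<open>\<mu>\<^sub>Q\<close> exceeds that of
  \<open>\<mu>\<close> by at least \<open>- \<integral>u * H\<mu> + (\<integral>u\<^sup>2 - (\<integral>u)\<^sup>2) / 4\<close>; the cotangent in the first-order term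
  is truncated near the diagonal and the truncation is removed at the end. The potential
  contributes at least \<open>\<integral>Q' * u + (\<rho> - 1 / 2) / 2 * \<integral>u\<^sup>2\<close>. The place where the circle is cut open
  to define \<open>b\<close> is chosen so that \<open>\<integral>u = 0\<close>; then the two quadratic terms add up to
  \<open>\<rho> / 2 * \<integral>u\<^sup>2\<close>, the constant \<open>\<integral>Q' \<partial>\<mu>\<close> may be added to \<open>H\<mu> - Q'\<close> for free, and completing
  the square gives the claim.
\<close>

section \<open>Two elementary inequalities and the cotangent kernel\<close>

text \<open>The kernel sees only the differences \<open>u p - u q\<close>, so its convexity says
  nothing about rotating the whole measure: it produces the variance of \<open>u\<close>, and only
  when \<open>u\<close> has mean zero is this the full second moment. Hence the 1/2 in the
  hypothesis: a second moment with weight 1/4 makes up exactly for a curvature deficit of 1/2 in the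
  potential. The subtracted square in \<open>circle_fisher\<close> has a parallel origin. By
  antisymmetry of the cotangent, H\<mu> has \<mu>-mean zero, so I_Q is the variance of H\<mu> - Q'
  under \<mu>, that is, the least value over constants c of the integral of (H\<mu> - Q' + c)^2.
  Monotonicity of \<open>a\<close> and \<open>b\<close> keeps \<open>a p - a q\<close> and
  \<open>b p - b q\<close> between the same two poles of the kernel, outside of which no convexity
  is available. The obstacle is the diagonal: \<open>u\<close> is only a difference of monotone
  functions and cannot tame the pole of the cotangent. Finiteness of the energy enters twice: it
  makes the diagonal a null set, and it excludes atoms, without which the mean angle would jump as
  the cut moves.\<close>

text \<open>Taylor's formula with Lagrange remainder. The unordered segment allows \<open>x\<close>
  on either side of \<open>c\<close>; the lemma serves both the logarithmic kernel, with
  \<open>k = 1 / 4\<close>, and the potential along an angle, with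
  \<open>k = \<rho> - 1 / 2\<close>.\<close>

lemma second_order_lower_bound:
  fixes f f' f'' :: "real \<Rightarrow> real"
  assumes f': "\<And>t. t \<in> closed_segment c x \<Longrightarrow> (f has_real_derivative f' t) (at t)"
    and f'': "\<And>t. t \<in> closed_segment c x \<Longrightarrow> (f' has_real_derivative f'' t) (at t)"
    and bound: "\<And>t. t \<in> closed_segment c x \<Longrightarrow> k \<le> f'' t"
  shows "f c + f' c * (x - c) + k / 2 * (x - c)\<^sup>2 \<le> f x"
proof (cases "x = c")
  case False
  define diff where "diff = (\<lambda>n::nat. if n = 0 then f else if n = 1 then f' else f'')"
  have "\<exists>t. (if x < c then x < t \<and> t < c else c < t \<and> t < x) \<and>
    f x = (\<Sum>m<2. (diff m c / fact m) * (x - c)^m) + (diff 2 t / fact 2) * (x - c)^2"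
  proof (rule Taylor)
    show "\<forall>m t. m < 2 \<and> min c x \<le> t \<and> t \<le> max c x \<longrightarrow>
        (diff m has_real_derivative diff (Suc m) t) (at t)"
    proof (intro allI impI)
      fix m :: nat and t assume *: "m < 2 \<and> min c x \<le> t \<and> t \<le> max c x"
      then have "t \<in> closed_segment c x"
        by (auto simp: closed_segment_eq_real_ivl)
      moreover have "m = 0 \<or> m = 1" using * by auto
      ultimately show "(diff m has_real_derivative diff (Suc m) t) (at t)"
        using f' f'' by (auto simp: diff_def)
    qed
  qed (use False in \<open>auto simp: diff_def\<close>)
  then obtain t where t: "if x < c then x < t \<and> t < c else c < t \<and> t < x"
    and eq: "f x = f c + f' c * (x - c) + f'' t / 2 * (x - c)\<^sup>2"
    by (auto simp: diff_def numeral_2_eq_2)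
  have "t \<in> closed_segment c x"
    using t by (auto simp: closed_segment_eq_real_ivl split: if_splits)
  then have "k / 2 * (x - c)\<^sup>2 \<le> f'' t / 2 * (x - c)\<^sup>2"
    using bound by (intro mult_right_mono divide_right_mono) auto
  with eq show ?thesis by simp
qed simp

text \<open>The second derivative of \<open>- ln (2 * sin (t / 2))\<close> is
  \<open>1 / (4 * (sin (t / 2))\<^sup>2)\<close>, smallest at antipodal points,
  \<open>t = pi\<close>. Half of the minimum 1/4 is the constant 1/8.\<close>

lemma ln_sin_half_second_order:
  fixes A B :: real
  assumes "0 < A" "A < 2 * pi" "0 < B" "B < 2 * pi"
  shows "ln (2 * sin (B / 2)) \<le>
    ln (2 * sin (A / 2)) + cot (A / 2) * (B - A) / 2 - (B - A)\<^sup>2 / 8"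
proof -
  have seg: "t \<in> closed_segment A B \<Longrightarrow> 0 < sin (t / 2)" for t
    using assms by (intro sin_gt_zero) (auto simp: closed_segment_eq_real_ivl split: if_splits)
  have "(\<lambda>t. - ln (2 * sin (t / 2))) A + (\<lambda>t. - cot (t / 2) / 2) A * (B - A) + (1/4) / 2 * (B - A)\<^sup>2
      \<le> (\<lambda>t. - ln (2 * sin (t / 2))) B"
  proof (rule second_order_lower_bound[where f'' = "\<lambda>t. inverse ((sin (t / 2))\<^sup>2) / 4"])
    fix t assume t: "t \<in> closed_segment A B"
    show "((\<lambda>t. - ln (2 * sin (t / 2))) has_real_derivative - cot (t / 2) / 2) (at t)"
      using seg[OF t] by (auto intro!: derivative_eq_intros simp: cot_def field_simps)
    show "((\<lambda>t. - cot (t / 2) / 2) has_real_derivative inverse ((sin (t / 2))\<^sup>2) / 4) (at t)"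
      using seg[OF t]
      by (auto intro!: derivative_eq_intros DERIV_chain2[OF DERIV_cot] simp: field_simps)
    have "0 < (sin (t / 2))\<^sup>2" "(sin (t / 2))\<^sup>2 \<le> 1"
      using seg[OF t] by (auto simp: abs_square_le_1)
    then show "1 / 4 \<le> inverse ((sin (t / 2))\<^sup>2) / 4"
      by (simp add: field_simps)
  qed
  then show ?thesis by simp
qed

lemma norm_cis_diff: "norm (cis a - cis b) = 2 * \<bar>sin ((a - b) / 2)\<bar>"
proof -
  have "(norm (cis a - cis b))\<^sup>2 = (cos a - cos b)\<^sup>2 + (sin a - sin b)\<^sup>2"
    by (simp add: cmod_power2)
  also have "\<dots> = 2 - 2 * (cos a * cos b + sin a * sin b)"
    using sin_cos_squared_add[of a] sin_cos_squared_add[of b]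
    by (simp add: power2_eq_square algebra_simps)
  also have "\<dots> = 2 - 2 * cos (2 * ((a - b) / 2))"
  proof -
    have "2 * ((a - b) / 2) = a - b" by simp
    then show ?thesis unfolding cos_diff[symmetric] by metis
  qed
  also have "\<dots> = (2 * \<bar>sin ((a - b) / 2)\<bar>)\<^sup>2"
    by (simp only: cos_double_sin) (simp add: power_mult_distrib)
  finally show ?thesis
    by (rule power2_eq_imp_eq) auto
qed

text \<open>The right-hand side depends on \<open>cis t\<close> only, which lets the kernel be
  defined on the circle without choosing an angle. Where \<open>sin (t / 2)\<close> vanishes, both
  sides are 0 because division by zero gives 0.\<close>

lemma cot_half: "cot (t / 2) = sin t / (1 - cos t)" for t :: real
proof (cases "sin (t / 2) = 0")
  case True
  then show ?thesis
    using sin_double[of "t / 2"] by (simp add: cot_def)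
next
  case False
  have "1 - cos t = 2 * (sin (t / 2))\<^sup>2"
    using cos_double_sin[of "t / 2"] by simp
  then show ?thesis
    using False sin_double[of "t / 2"] by (simp add: cot_def power2_eq_square)
qed

text \<open>This is \<open>t / 2 \<le> tan (t / 2)\<close>. It converts a Lipschitz increment of the
  density into a bound on its product with the singular kernel.\<close>

lemma abs_cot_half_mult_le:
  fixes t :: real
  assumes "\<bar>t\<bar> \<le> pi"
  shows "\<bar>cot (t / 2) * t\<bar> \<le> 2"
proof -
  have pos: "\<bar>cot (t / 2) * t\<bar> \<le> 2" if "0 < t" "t < pi" for t :: real
  proof -
    have s: "0 < sin (t / 2)" "0 < cos (t / 2)"
      using that by (auto intro!: sin_gt_zero cos_gt_zero)
    have "t / 2 \<le> tan (t / 2)"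
      using abs_tan_ge[of "t / 2"] that s by (simp add: tan_def)
    then show ?thesis
      using s that by (simp add: tan_def cot_def field_simps abs_mult)
  qed
  consider "t = 0" | "t = pi" | "t = - pi" | "0 < t" "t < pi" | "0 < - t" "- t < pi"
    using assms by linarith
  then show ?thesis
  proof cases
    case 5
    then show ?thesis using pos[of "-t"] assms by simp
  qed (use pos in \<open>auto simp: cot_def\<close>)
qed

lemma cis_Arg_circle:
  assumes "z \<in> unit_circle"
  shows "cis (Arg z) = z"
proof -
  have "norm z = 1" "z \<noteq> 0" using assms by auto
  then show ?thesis
    using cis_Arg[of z] by (simp add: sgn_div_norm)
qed

text \<open>The truncated kernel of the Hilbert transform: on \<open>cis t\<close> with \<open>\<bar>t\<bar> \<le> pi\<close> it is
  \<open>cot (t / 2)\<close> for \<open>\<bar>t\<bar> > \<epsilon>\<close>.\<close>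

definition cot_kernel :: "real \<Rightarrow> complex \<Rightarrow> real" where
  "cot_kernel \<epsilon> w = (if Re w < cos \<epsilon> then Im w / (1 - Re w) else 0)"

lemma cot_kernel_measurable [measurable]: "cot_kernel \<epsilon> \<in> borel_measurable borel"
  unfolding cot_kernel_def by measurable

lemma cot_kernel_cnj: "cot_kernel \<epsilon> (cnj w) = - cot_kernel \<epsilon> w"
  by (simp add: cot_kernel_def)

lemma cot_kernel_cis:
  "cot_kernel \<epsilon> (cis t) = (if cos t < cos \<epsilon> then cot (t / 2) else 0)"
  by (simp add: cot_kernel_def cot_half)

lemma cot_kernel_cis_diff: "cot_kernel \<epsilon> (cis a * cnj (cis b)) = cot_kernel \<epsilon> (cis (a - b))"
  by (simp add: cis_cnj cis_mult)

lemma abs_cot_kernel_le: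
  assumes "w \<in> unit_circle" "cos \<epsilon> < 1"
  shows "\<bar>cot_kernel \<epsilon> w\<bar> \<le> 1 / (1 - cos \<epsilon>)"
proof -
  have "\<bar>Im w\<bar> \<le> 1" using abs_Im_le_cmod[of w] assms by simp
  then show ?thesis
    using assms unfolding cot_kernel_def by (auto intro!: frac_le)
qed

lemma cos_less_cos_iff:
  assumes "\<bar>t\<bar> \<le> pi" "0 < \<epsilon>" "\<epsilon> < pi"
  shows "cos t < cos \<epsilon> \<longleftrightarrow> \<epsilon> < \<bar>t\<bar>"
  using cos_mono_less_eq[of "\<bar>t\<bar>" \<epsilon>] assms by simp

section \<open>Haar measure and integrability of the logarithmic kernel\<close>

lemma sets_circle_haar [simp, measurable_cong]: "sets circle_haar = sets circle_borel"
  using circle_prob_haar by (simp add: circle_prob_def)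

lemma space_circle_haar [simp]: "space circle_haar = unit_circle"
  using sets_eq_imp_space_eq[OF sets_circle_haar] by (simp add: space_restrict_space)

lemma rotation_measurable:
  assumes "w \<in> unit_circle"
  shows "(\<lambda>z. w * z) \<in> circle_borel \<rightarrow>\<^sub>M circle_borel"
  using assms by (intro measurable_restrict_space2 measurable_restrict_space1)
                 (auto simp: space_restrict_space norm_mult)

lemma nn_integral_circle_haar_rotation:
  assumes "w \<in> unit_circle" "f \<in> borel_measurable circle_borel"
  shows "(\<integral>\<^sup>+z. f (w * z) \<partial>circle_haar) = (\<integral>\<^sup>+z. f z \<partial>circle_haar)"
proof -
  have "(\<integral>\<^sup>+z. f z \<partial>circle_haar) = (\<integral>\<^sup>+z. f z \<partial>distr circle_haar circle_haar (\<lambda>z. w * z))"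
    using circle_haar_rotation[OF assms(1)] by simp
  also have "\<dots> = (\<integral>\<^sup>+z. f (w * z) \<partial>circle_haar)"
    using rotation_measurable[OF assms(1)] assms(2)
    by (intro nn_integral_distr) (simp_all cong: measurable_cong_sets)
  finally show ?thesis by simp
qed

lemma integral_circle_haar_rotation:
  fixes f :: "complex \<Rightarrow> real"
  assumes "w \<in> unit_circle" "f \<in> borel_measurable circle_borel"
  shows "(\<integral>z. f (w * z) \<partial>circle_haar) = (\<integral>z. f z \<partial>circle_haar)"
proof -
  have "(\<integral>z. f z \<partial>circle_haar) = (\<integral>z. f z \<partial>distr circle_haar circle_haar (\<lambda>z. w * z))"
    using circle_haar_rotation[OF assms(1)] by simp
  also have "\<dots> = (\<integral>z. f (w * z) \<partial>circle_haar)"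
    using rotation_measurable[OF assms(1)] assms(2)
    by (intro integral_distr) (simp_all cong: measurable_cong_sets)
  finally show ?thesis by simp
qed

text \<open>Rotation by -1 shifts the angle by \<open>pi\<close> and so centres the period at 0,
  where the kernels are singular and where oddness of the cotangent can be used. The endpoint
  \<open>-pi\<close> is dropped as a null set.\<close>

lemma nn_integral_circle_haar_symmetric:
  assumes f: "f \<in> borel_measurable circle_borel"
  shows "(\<integral>\<^sup>+z. f z \<partial>circle_haar) =
    (\<integral>\<^sup>+t\<in>{-pi<..<pi}. f (cis t) \<partial>lborel) / ennreal (2 * pi)"
proof -
  have [measurable]: "(\<lambda>t. f (cis t)) \<in> borel_measurable borel"
    using measurable_compose[OF cis_measurable_circle f] .
  have f': "(\<lambda>z. f (-1 * z)) \<in> borel_measurable circle_borel"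
    using measurable_compose[OF rotation_measurable f, of "-1"] by simp
  have "(\<integral>\<^sup>+z. f z \<partial>circle_haar) = (\<integral>\<^sup>+z. f (-1 * z) \<partial>circle_haar)"
    using nn_integral_circle_haar_rotation[OF _ f, of "-1"] by simp
  also have "\<dots> = (\<integral>\<^sup>+t\<in>{0..<2 * pi}. f (-1 * cis t) \<partial>lborel) / ennreal (2 * pi)"
    by (rule nn_integral_circle_haar[OF f'])
  also have "(\<integral>\<^sup>+t\<in>{0..<2 * pi}. f (-1 * cis t) \<partial>lborel) =
     (\<integral>\<^sup>+t. (\<lambda>t. f (cis t) * indicator {-pi..<pi} t) (- pi + t) \<partial>lborel)"
    by (intro nn_integral_cong)
       (auto simp: indicator_def cis_mult[symmetric] cis_divide[symmetric])
  also have "\<dots> = (\<integral>\<^sup>+t. (\<lambda>t. f (cis t) * indicator {-pi..<pi} t) t \<partial>lborel)"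
    by (rule nn_integral_lborel_shift) simp
  also have "\<dots> = (\<integral>\<^sup>+t\<in>{-pi<..<pi}. f (cis t) \<partial>lborel)"
    using AE_lborel_singleton[of "-pi"]
    by (intro nn_integral_cong_AE) (auto simp: indicator_def)
  finally show ?thesis .
qed

lemma circle_haar_eq_distr:
  "circle_haar = distr (density lborel (\<lambda>t. ennreal (indicator {-pi<..<pi} t / (2 * pi)))) circle_borel cis"
  (is "_ = distr ?L _ _")
proof (rule measure_eqI)
  fix A assume A: "A \<in> sets circle_haar"
  have m: "cis \<in> ?L \<rightarrow>\<^sub>M circle_borel"
    using cis_measurable_circle by simp
  have f: "(indicator A :: complex \<Rightarrow> ennreal) \<in> borel_measurable circle_borel"
    using A by simp
  have [measurable]: "(\<lambda>t. indicator A (cis t) :: ennreal) \<in> borel_measurable borel"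
    using measurable_compose[OF cis_measurable_circle f] .
  have "emeasure circle_haar A = (\<integral>\<^sup>+z. indicator A z \<partial>circle_haar)"
    using A by simp
  also have "\<dots> = (\<integral>\<^sup>+t. indicator A (cis t) * indicator {-pi<..<pi} t \<partial>lborel) / ennreal (2 * pi)"
    by (rule nn_integral_circle_haar_symmetric[OF f])
  also have "\<dots> = (\<integral>\<^sup>+t. indicator A (cis t) * indicator {-pi<..<pi} t / ennreal (2 * pi) \<partial>lborel)"
    by (rule nn_integral_divide[symmetric]) simp
  also have "\<dots> = (\<integral>\<^sup>+t. ennreal (indicator {-pi<..<pi} t / (2 * pi)) * indicator A (cis t) \<partial>lborel)"
    by (intro nn_integral_cong) (auto simp: indicator_def divide_ennreal[symmetric])
  also have "\<dots> = (\<integral>\<^sup>+t. indicator A (cis t) \<partial>?L)"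
    by (subst nn_integral_density) simp_all
  also have "\<dots> = (\<integral>\<^sup>+z. indicator A z \<partial>distr ?L circle_borel cis)"
    using f by (intro nn_integral_distr[OF m, symmetric]) (simp cong: measurable_cong_sets)
  also have "\<dots> = emeasure (distr ?L circle_borel cis) A"
    using A by simp
  finally show "emeasure circle_haar A = emeasure (distr ?L circle_borel cis) A" .
qed simp

lemma integral_circle_haar:
  fixes f :: "complex \<Rightarrow> real"
  assumes f: "f \<in> borel_measurable circle_borel"
  shows "(\<integral>z. f z \<partial>circle_haar) = (LINT t|lborel. indicator {-pi<..<pi} t / (2 * pi) * f (cis t))"
proof -
  have [measurable]: "(\<lambda>t. f (cis t)) \<in> borel_measurable borel"
    using measurable_compose[OF cis_measurable_circle f] .
  show ?thesis
    by (subst circle_haar_eq_distr, subst integral_distr)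
       (use cis_measurable_circle f in \<open>auto simp: integral_density\<close>)
qed

section \<open>An integrable majorant for the logarithmic singularity\<close>

lemma nn_integral_inverse_sqrt_finite:
  "(\<integral>\<^sup>+t\<in>{-pi<..<pi}. ennreal (2 * (\<bar>t\<bar> / 2) powr (- 1 / 2)) \<partial>lborel) < \<infinity>"
proof -
  define g :: "real \<Rightarrow> real" where "g t = 2 * (t / 2) powr (- 1 / 2)" for t
  have [measurable]: "g \<in> borel_measurable borel"
    unfolding g_def by measurable
  have "(\<lambda>t. t powr (- 1 / 2)) integrable_on {0..pi}"
    by (rule integrable_on_powr_from_0) auto
  then have "(\<lambda>t. (2 / (1/2) powr (1 / 2)) * t powr (- 1 / 2)) integrable_on {0..pi}"
    by (rule integrable_on_mult_right)
  also have "?this \<longleftrightarrow> g integrable_on {0..pi}"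
    by (intro integrable_cong) (auto simp: g_def powr_divide powr_minus field_simps)
  finally have "(g has_integral (integral {0..pi} g)) {0..pi}"
    by (rule integrable_integral)
  then have "((\<lambda>t. if t \<in> {0..pi} then g t else 0) has_integral (integral {0..pi} g)) UNIV"
    by (simp only: has_integral_restrict_UNIV)
  then have "((\<lambda>t. g t * indicator {0..pi} t) has_integral (integral {0..pi} g)) UNIV"
    by (rule has_integral_eq[rotated]) (auto simp: indicator_def)
  then have fin: "(\<integral>\<^sup>+t. ennreal (g t * indicator {0..pi} t) \<partial>lborel) < \<infinity>"
    by (subst nn_integral_has_integral_lborel) (auto simp: g_def)
  have "(\<integral>\<^sup>+t. ennreal (g t * indicator {0..pi} t) \<partial>lborel) =
     (\<integral>\<^sup>+t. ennreal (g (- t) * indicator {0..pi} (- t)) \<partial>lborel)"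
    by (subst nn_integral_real_affine[where c = "-1" and t = 0]) auto
  with fin have fin': "(\<integral>\<^sup>+t. ennreal (g (- t) * indicator {0..pi} (- t)) \<partial>lborel) < \<infinity>"
    by simp
  have "(\<integral>\<^sup>+t\<in>{-pi<..<pi}. ennreal (2 * (\<bar>t\<bar> / 2) powr (- 1 / 2)) \<partial>lborel) \<le>
     (\<integral>\<^sup>+t. ennreal (g t * indicator {0..pi} t) + ennreal (g (- t) * indicator {0..pi} (- t)) \<partial>lborel)"
    by (intro nn_integral_mono) (auto simp: indicator_def g_def abs_if split: if_splits)
  also have "\<dots> = (\<integral>\<^sup>+t. ennreal (g t * indicator {0..pi} t) \<partial>lborel) +
      (\<integral>\<^sup>+t. ennreal (g (- t) * indicator {0..pi} (- t)) \<partial>lborel)"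
    by (rule nn_integral_add) auto
  also have "\<dots> < \<infinity>"
    using fin fin' by (simp add: less_top)
  finally show ?thesis .
qed

lemma neg_ln_le_inverse_sqrt:
  fixes y :: real
  assumes "0 < y"
  shows "- ln y \<le> 2 * y powr (- 1 / 2)"
proof -
  have "- ln y = 2 * ln (y powr (- 1 / 2))"
    using assms by (simp add: ln_powr)
  also have "ln (y powr (- 1 / 2)) \<le> y powr (- 1 / 2)"
    using assms ln_le_minus_one[of "y powr (- 1 / 2)"] by simp
  finally show ?thesis by simp
qed

text \<open>A chord is at least half its arc: halving the angle once more,
  \<open>2 * sin (t / 2)\<close> is \<open>4 * sin (t / 4) * cos (t / 4)\<close>, and the loss
  against \<open>t\<close> is the factor \<open>(cos (t / 4))\<^sup>2\<close>, at least 1/2 in this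
  range.\<close>

lemma abs_half_le_two_sin_half:
  fixes t :: real
  assumes "\<bar>t\<bar> \<le> pi"
  shows "\<bar>t\<bar> / 2 \<le> 2 * \<bar>sin (t / 2)\<bar>"
proof -
  have "t / 2 \<le> 2 * sin (t / 2)" if "0 < t" "t \<le> pi" for t :: real
  proof -
    have c: "0 < cos (t / 4)" "0 < sin (t / 4)"
      using that by (auto intro!: cos_gt_zero sin_gt_zero)
    have "t / 4 \<le> tan (t / 4)"
      using abs_tan_ge[of "t / 4"] that c by (simp add: tan_def)
    then have 1: "t / 4 * cos (t / 4) \<le> sin (t / 4)"
      using c by (simp add: tan_def field_simps)
    have "0 \<le> cos (t / 2)"
      using that by (intro cos_ge_zero) auto
    then have 2: "1 / 2 \<le> (cos (t / 4))\<^sup>2"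
      using cos_double_cos[of "t / 4"] by simp
    have "t / 2 = t * (1 / 2)" by simp
    also have "\<dots> \<le> t * (cos (t / 4))\<^sup>2"
      using 2 that by (intro mult_left_mono) auto
    also have "\<dots> = 4 * (t / 4 * cos (t / 4)) * cos (t / 4)"
      by (simp add: power2_eq_square)
    also have "\<dots> \<le> 4 * sin (t / 4) * cos (t / 4)"
      using 1 c by (intro mult_right_mono mult_left_mono) auto
    also have "\<dots> = 2 * sin (t / 2)"
      using sin_double[of "t / 4"] by simp
    finally show ?thesis .
  qed
  note * = this
  consider "t = 0" | "0 < t" | "0 < - t" by linarith
  then show ?thesis
  proof cases
    case 2 then show ?thesis using *[of t] assms by simp
  next
    case 3 then show ?thesis using *[of "-t"] assms by simp
  qed simp
qed

lemma log_dist_measurable [measurable]: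
  "(\<lambda>x. log_dist (fst x) (snd x)) \<in> borel_measurable (borel \<Otimes>\<^sub>M borel)"
  unfolding log_dist_def by measurable

lemma log_dist_rotate:
  assumes "w \<in> unit_circle"
  shows "log_dist (w * x) (w * y) = log_dist x y"
  using assms unfolding log_dist_def
  by (auto simp: norm_mult right_diff_distrib[symmetric])

text \<open>Rotation invariance makes the logarithmic potential of Haar measure constant on the
  circle, so a single finite integral bounds it everywhere.\<close>

lemma nn_integral_haar_log_dist:
  assumes "z \<in> unit_circle"
  shows "(\<integral>\<^sup>+w. e2ennreal (- log_dist z w) \<partial>circle_haar) = (\<integral>\<^sup>+w. e2ennreal (- log_dist 1 w) \<partial>circle_haar)"
    and "(\<integral>\<^sup>+w. e2ennreal (- log_dist 1 w) \<partial>circle_haar) < \<infinity>"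
proof -
  have "(\<lambda>w. log_dist z w) \<in> borel_measurable borel" for z
    using measurable_compose[OF _ log_dist_measurable, of "\<lambda>w. (z, w)"] by simp
  then have m: "(\<lambda>w. e2ennreal (- log_dist z w)) \<in> borel_measurable circle_borel" for z
    by (intro measurable_restrict_space1) simp
  have "(\<integral>\<^sup>+w. e2ennreal (- log_dist z w) \<partial>circle_haar) = (\<integral>\<^sup>+w. e2ennreal (- log_dist z (z * w)) \<partial>circle_haar)"
    by (rule nn_integral_circle_haar_rotation[OF assms m, symmetric])
  also have "\<dots> = (\<integral>\<^sup>+w. e2ennreal (- log_dist 1 w) \<partial>circle_haar)"
    using log_dist_rotate[OF assms, of 1] by simp
  finally show "(\<integral>\<^sup>+w. e2ennreal (- log_dist z w) \<partial>circle_haar) = (\<integral>\<^sup>+w. e2ennreal (- log_dist 1 w) \<partial>circle_haar)" .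
  have "(\<integral>\<^sup>+t\<in>{-pi<..<pi}. e2ennreal (- log_dist 1 (cis t)) \<partial>lborel) \<le>
     (\<integral>\<^sup>+t\<in>{-pi<..<pi}. ennreal (2 * (\<bar>t\<bar> / 2) powr (- 1 / 2)) \<partial>lborel)"
  proof (rule nn_integral_mono_AE)
    \<comment> \<open>The bound fails at \<open>t = 0\<close>, where the left side is infinite while
      \<open>0 powr (- 1 / 2)\<close> is 0; hence almost everywhere only.\<close>
    show "AE t in lborel. e2ennreal (- log_dist 1 (cis t)) * indicator {-pi<..<pi} t \<le>
       ennreal (2 * (\<bar>t\<bar> / 2) powr (- 1 / 2)) * indicator {-pi<..<pi} t"
      using AE_lborel_singleton[of 0]
    proof eventually_elim
      fix t :: real assume "t \<noteq> 0"
      show "e2ennreal (- log_dist 1 (cis t)) * indicator {-pi<..<pi} t \<le>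
       ennreal (2 * (\<bar>t\<bar> / 2) powr (- 1 / 2)) * indicator {-pi<..<pi} t"
      proof (cases "t \<in> {-pi<..<pi}")
        case True
        have n: "norm (1 - cis t) = 2 * \<bar>sin (t / 2)\<bar>"
          using norm_cis_diff[of 0 t] by simp
        have l: "\<bar>t\<bar> / 2 \<le> norm (1 - cis t)"
          unfolding n using True by (intro abs_half_le_two_sin_half) auto
        with \<open>t \<noteq> 0\<close> have p: "0 < norm (1 - cis t)" by linarith
        have "- ln (norm (1 - cis t)) \<le> - ln (\<bar>t\<bar> / 2)"
          using l p \<open>t \<noteq> 0\<close> by simp
        also have "\<dots> \<le> 2 * (\<bar>t\<bar> / 2) powr (- 1 / 2)"
          using \<open>t \<noteq> 0\<close> by (intro neg_ln_le_inverse_sqrt) auto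
        finally show ?thesis
          using p True by (auto simp: log_dist_def e2ennreal_ereal intro!: ennreal_leI)
      qed simp
    qed
  qed
  also have "\<dots> < \<infinity>" by (rule nn_integral_inverse_sqrt_finite)
  finally show "(\<integral>\<^sup>+w. e2ennreal (- log_dist 1 w) \<partial>circle_haar) < \<infinity>"
    unfolding nn_integral_circle_haar_symmetric[OF m]
    by (simp add: less_top[symmetric] ennreal_divide_eq_top_iff)
qed

section \<open>Functions on the circle and logarithmic energy\<close>

text \<open>\<open>Arg\<close> is continuous off the nonpositive real axis and equals
  \<open>pi\<close> on it, except for the value 0 at the origin.\<close>

lemma Arg_borel_measurable [measurable]: "Arg \<in> borel_measurable borel"
proof -
  have "(\<lambda>z. indicat_real (- \<real>\<^sub>\<le>\<^sub>0) z *\<^sub>R Arg z) \<in> borel_measurable borel"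
    by (intro borel_measurable_continuous_on_indicator continuous_on_Arg) auto
  then have "(\<lambda>z. if z \<in> \<real>\<^sub>\<le>\<^sub>0 then if z = 0 then 0 else pi
      else indicat_real (- \<real>\<^sub>\<le>\<^sub>0) z *\<^sub>R Arg z) \<in> borel_measurable borel"
    by (intro measurable_If_set) auto
  also have "(\<lambda>z. if z \<in> \<real>\<^sub>\<le>\<^sub>0 then if z = 0 then 0 else pi
      else indicat_real (- \<real>\<^sub>\<le>\<^sub>0) z *\<^sub>R Arg z) = Arg"
    using Arg_eq_pi by (auto simp: fun_eq_iff Arg_zero elim!: nonpos_Reals_cases)
  finally show ?thesis .
qed

text \<open>Differentiability at 0 along the rotations of every point is, after a translation of the
  angle, differentiability of the lift to the line at every angle.\<close>

lemma circle_Ck_has_derivative: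
  assumes "circle_Ck k \<phi>" "j < k"
  shows "((\<lambda>t. (circle_deriv ^^ j) \<phi> (cis t)) has_real_derivative (circle_deriv ^^ Suc j) \<phi> (cis t)) (at t)"
proof -
  define \<psi> where "\<psi> = (circle_deriv ^^ j) \<phi>"
  have "(\<lambda>s. \<psi> (cis t * cis s)) differentiable (at 0)"
    using assms by (simp add: circle_Ck_def \<psi>_def)
  then have "((\<lambda>s. \<psi> (cis t * cis s)) has_real_derivative circle_deriv \<psi> (cis t)) (at 0)"
    by (simp add: circle_deriv_def DERIV_deriv_iff_real_differentiable)
  then have "((\<lambda>s. \<psi> (cis (s + t))) has_real_derivative circle_deriv \<psi> (cis t)) (at 0)"
    by (simp add: cis_mult add.commute)
  then have "((\<lambda>t. \<psi> (cis t)) has_real_derivative circle_deriv \<psi> (cis t)) (at (0 + t))"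
    by (subst DERIV_shift)
  then show ?thesis
    by (simp add: \<psi>_def)
qed

text \<open>The values of \<open>\<psi>\<close> off the circle are arbitrary, so everything is read
  off from \<open>\<psi> (cis (Arg z))\<close>.\<close>

lemma circle_function_measurable_bounded:
  fixes \<psi> :: "complex \<Rightarrow> real"
  assumes cont: "continuous_on UNIV (\<lambda>t. \<psi> (cis t))"
  shows "\<psi> \<in> borel_measurable circle_borel"
    and "\<exists>C\<ge>0. \<forall>z\<in>unit_circle. \<bar>\<psi> z\<bar> \<le> C"
proof -
  have eq: "\<psi> z = \<psi> (cis (Arg z))" if "z \<in> unit_circle" for z
    using cis_Arg_circle[OF that] by simp
  have "(\<lambda>t. \<psi> (cis t)) \<in> borel_measurable borel"
    using cont by (rule borel_measurable_continuous_onI)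
  then have "(\<lambda>z. \<psi> (cis (Arg z))) \<in> borel_measurable borel"
    using measurable_compose[OF Arg_borel_measurable] by blast
  then have "(\<lambda>z. \<psi> (cis (Arg z))) \<in> borel_measurable circle_borel"
    by (rule measurable_restrict_space1)
  then show "\<psi> \<in> borel_measurable circle_borel"
    by (subst measurable_cong[OF eq]) (auto simp: space_restrict_space)
  have "compact ((\<lambda>t. \<psi> (cis t)) ` {-pi..pi})"
    by (intro compact_continuous_image continuous_on_subset[OF cont]) auto
  then obtain C where C: "\<forall>t\<in>{-pi..pi}. \<bar>\<psi> (cis t)\<bar> \<le> C"
    by (auto dest!: compact_imp_bounded simp: bounded_iff)
  have "\<bar>\<psi> z\<bar> \<le> C" if "z \<in> unit_circle" for z
    using C Arg_bounded[of z] eq[OF that] by auto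
  then show "\<exists>C\<ge>0. \<forall>z\<in>unit_circle. \<bar>\<psi> z\<bar> \<le> C"
    by (intro exI[of _ "max 0 C"]) (auto simp: le_max_iff_disj)
qed

section \<open>Measures on the circle of finite logarithmic energy\<close>

lemma circle_prob_space: "circle_prob \<kappa> \<Longrightarrow> space \<kappa> = unit_circle"
  using sets_eq_imp_space_eq[of \<kappa> circle_borel] by (simp add: circle_prob_def space_restrict_space)

lemma circle_prob_measurable:
  assumes "circle_prob \<kappa>"
  shows "f \<in> measurable circle_borel N \<Longrightarrow> f \<in> measurable \<kappa> N"
    and "f \<in> measurable borel N \<Longrightarrow> f \<in> measurable \<kappa> N"
proof -
  have "sets \<kappa> = sets circle_borel" using assms by (simp add: circle_prob_def)
  then have eq: "measurable \<kappa> N = measurable circle_borel N"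
    by (intro measurable_cong_sets) simp_all
  show "f \<in> measurable circle_borel N \<Longrightarrow> f \<in> measurable \<kappa> N"
    unfolding eq .
  show "f \<in> measurable borel N \<Longrightarrow> f \<in> measurable \<kappa> N"
    unfolding eq by (rule measurable_restrict_space1)
qed

lemma circle_prob_pair_measurable:
  assumes "circle_prob \<kappa>" "f \<in> measurable (borel \<Otimes>\<^sub>M borel) N"
  shows "f \<in> measurable (\<kappa> \<Otimes>\<^sub>M \<kappa>) N"
proof -
  have "(\<lambda>z. z) \<in> measurable \<kappa> borel"
    by (rule circle_prob_measurable(2)[OF assms(1)]) simp
  then have "(\<lambda>p. (fst p, snd p)) \<in> measurable (\<kappa> \<Otimes>\<^sub>M \<kappa>) (borel \<Otimes>\<^sub>M borel)"
    by (intro measurable_Pair measurable_compose[OF measurable_fst] measurable_compose[OF measurable_snd])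
  from measurable_compose[OF this assms(2)] show ?thesis by simp
qed

text \<open>Chords have length at most 2, so the positive part of \<open>log_dist\<close> is bounded
  and only the negative part can diverge.\<close>

definition finite_log_energy :: "complex measure \<Rightarrow> bool" where
  "finite_log_energy \<kappa> \<longleftrightarrow>
    (\<integral>\<^sup>+p. e2ennreal (- log_dist (fst p) (snd p)) \<partial>(\<kappa> \<Otimes>\<^sub>M \<kappa>)) < \<infinity>"

lemma log_dist_pos_part_finite:
  assumes "circle_prob \<kappa>"
  shows "(\<integral>\<^sup>+p. e2ennreal (log_dist (fst p) (snd p)) \<partial>(\<kappa> \<Otimes>\<^sub>M \<kappa>)) < \<infinity>"
proof -
  interpret prob_space \<kappa> using assms by (simp add: circle_prob_def)
  interpret P: pair_prob_space \<kappa> \<kappa> ..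
  have "(\<integral>\<^sup>+p. e2ennreal (log_dist (fst p) (snd p)) \<partial>(\<kappa> \<Otimes>\<^sub>M \<kappa>)) \<le> (\<integral>\<^sup>+p. ennreal (ln 2) \<partial>(\<kappa> \<Otimes>\<^sub>M \<kappa>))"
  proof (rule nn_integral_mono)
    fix p assume "p \<in> space (\<kappa> \<Otimes>\<^sub>M \<kappa>)"
    then have "norm (fst p) = 1" "norm (snd p) = 1"
      by (auto simp: space_pair_measure circle_prob_space[OF assms])
    then have "norm (fst p - snd p) \<le> 2"
      using norm_triangle_ineq4[of "fst p" "snd p"] by simp
    then show "e2ennreal (log_dist (fst p) (snd p)) \<le> ennreal (ln 2)"
      by (simp add: log_dist_def e2ennreal_neg ennreal_leI)
  qed
  also have "\<dots> < \<infinity>"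
    by (simp add: P.emeasure_space_1)
  finally show ?thesis .
qed

lemma log_energy_infinite:
  assumes "circle_prob \<kappa>" "\<not> finite_log_energy \<kappa>"
  shows "log_energy Q \<kappa> = \<infinity>"
proof -
  define P where "P = (\<integral>\<^sup>+p. e2ennreal (log_dist (fst p) (snd p)) \<partial>(\<kappa> \<Otimes>\<^sub>M \<kappa>))"
  have "P < \<infinity>" using log_dist_pos_part_finite[OF assms(1)] by (simp add: P_def)
  then have "\<bar>enn2ereal P\<bar> \<noteq> \<infinity>"
    by (cases P) auto
  moreover have "(\<integral>\<^sup>+p. e2ennreal (- log_dist (fst p) (snd p)) \<partial>(\<kappa> \<Otimes>\<^sub>M \<kappa>)) = \<infinity>"
    using assms(2) by (simp add: finite_log_energy_def less_top[symmetric])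
  ultimately show ?thesis
    unfolding log_energy_def ext_integral_def
    by (cases "enn2ereal P") (auto simp: P_def case_prod_unfold)
qed

text \<open>A finite integral excludes infinite values on a set of positive measure, so the diagonal
  is null. Off the diagonal \<open>log_dist\<close> is the real logarithm, and the difference of
  extended integrals is an ordinary Bochner integral.\<close>

lemma finite_log_energy_facts:
  assumes \<kappa>: "circle_prob \<kappa>" and fin: "finite_log_energy \<kappa>"
  shows "AE p in \<kappa> \<Otimes>\<^sub>M \<kappa>. fst p \<noteq> snd p"
    and "integrable (\<kappa> \<Otimes>\<^sub>M \<kappa>) (\<lambda>p. ln (norm (fst p - snd p)))"
    and "log_energy Q \<kappa> =
      ereal ((\<integral>z. Q z \<partial>\<kappa>) - (\<integral>p. ln (norm (fst p - snd p)) \<partial>(\<kappa> \<Otimes>\<^sub>M \<kappa>)))"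
proof -
  define f where "f p = ln (norm (fst p - snd p))" for p :: "complex \<times> complex"
  define P where "P = (\<integral>\<^sup>+p. e2ennreal (log_dist (fst p) (snd p)) \<partial>(\<kappa> \<Otimes>\<^sub>M \<kappa>))"
  define N where "N = (\<integral>\<^sup>+p. e2ennreal (- log_dist (fst p) (snd p)) \<partial>(\<kappa> \<Otimes>\<^sub>M \<kappa>))"
  have [measurable]: "(\<lambda>p. log_dist (fst p) (snd p)) \<in> borel_measurable (\<kappa> \<Otimes>\<^sub>M \<kappa>)"
    by (rule circle_prob_pair_measurable[OF \<kappa>]) simp
  have [measurable]: "f \<in> borel_measurable (\<kappa> \<Otimes>\<^sub>M \<kappa>)"
    unfolding f_def by (rule circle_prob_pair_measurable[OF \<kappa>]) simp
  have P: "P < \<infinity>" using log_dist_pos_part_finite[OF \<kappa>] by (simp add: P_def)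
  have N: "N < \<infinity>" using fin by (simp add: N_def finite_log_energy_def)
  have "AE p in \<kappa> \<Otimes>\<^sub>M \<kappa>. e2ennreal (- log_dist (fst p) (snd p)) \<noteq> \<infinity>"
    using N by (intro nn_integral_PInf_AE) (auto simp: N_def)
  then show AE: "AE p in \<kappa> \<Otimes>\<^sub>M \<kappa>. fst p \<noteq> snd p"
    by eventually_elim (auto simp: log_dist_def)
  have P_eq: "P = (\<integral>\<^sup>+p. ennreal (f p) \<partial>(\<kappa> \<Otimes>\<^sub>M \<kappa>))"
    unfolding P_def by (intro nn_integral_cong_AE, use AE in eventually_elim) (auto simp: log_dist_def f_def)
  have N_eq: "N = (\<integral>\<^sup>+p. ennreal (- f p) \<partial>(\<kappa> \<Otimes>\<^sub>M \<kappa>))"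
    unfolding N_def by (intro nn_integral_cong_AE, use AE in eventually_elim) (auto simp: log_dist_def f_def)
  have int: "integrable (\<kappa> \<Otimes>\<^sub>M \<kappa>) f"
    using P N by (auto simp: real_integrable_def P_eq N_eq)
  then show "integrable (\<kappa> \<Otimes>\<^sub>M \<kappa>) (\<lambda>p. ln (norm (fst p - snd p)))"
    by (simp add: f_def[abs_def])
  have "(\<integral>p. f p \<partial>(\<kappa> \<Otimes>\<^sub>M \<kappa>)) = enn2real P - enn2real N"
    unfolding P_eq N_eq by (rule real_lebesgue_integral_def[OF int])
  moreover have "enn2ereal P = ereal (enn2real P)" "enn2ereal N = ereal (enn2real N)"
    using P N by (cases P; cases N; simp)+
  ultimately show "log_energy Q \<kappa> =
      ereal ((\<integral>z. Q z \<partial>\<kappa>) - (\<integral>p. ln (norm (fst p - snd p)) \<partial>(\<kappa> \<Otimes>\<^sub>M \<kappa>)))"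
    by (simp add: log_energy_def ext_integral_def case_prod_unfold P_def N_def f_def[abs_def])
qed

lemma smooth_density_continuous: "smooth_density \<mu> m \<Longrightarrow> continuous_on unit_circle m"
  by (auto simp: smooth_density_def circle_smooth_def circle_Ck_def dest!: spec[of _ 0])

lemma smooth_density_measurable:
  "smooth_density \<mu> m \<Longrightarrow> m \<in> borel_measurable circle_borel"
  using smooth_density_continuous by (rule borel_measurable_continuous_on_restrict)

text \<open>The density is continuous on a compact set, hence at most some \<open>C\<close>; its
  potential is then at most \<open>C\<close> times that of Haar measure, a finite constant.\<close>

lemma finite_log_energy_smooth:
  assumes \<mu>: "circle_prob \<mu>" and m: "smooth_density \<mu> m"
  shows "finite_log_energy \<mu>"
proof -
  interpret prob_space \<mu> using \<mu> by (simp add: circle_prob_def)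
  have "compact (m ` unit_circle)"
    using smooth_density_continuous[OF m] by (intro compact_continuous_image) auto
  then obtain C where "\<forall>z\<in>unit_circle. \<bar>m z\<bar> \<le> C"
    by (auto dest!: compact_imp_bounded simp: bounded_iff)
  then have C: "m z \<le> C" if "z \<in> unit_circle" for z
    using that by (meson abs_le_D1)
  have [measurable]: "m \<in> borel_measurable circle_haar"
    using smooth_density_measurable[OF m] by (simp cong: measurable_cong_sets)
  define f where "f p = e2ennreal (- log_dist (fst p) (snd p))" for p
  have [measurable]: "f \<in> borel_measurable (borel \<Otimes>\<^sub>M borel)"
    unfolding f_def by simp
  have f: "(\<lambda>w. f (z, w)) \<in> borel_measurable borel" for z
    by simp
  have "(\<lambda>w. f (z, w)) \<in> borel_measurable circle_borel" for z
    using f by (rule measurable_restrict_space1)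
  then have f' [measurable]: "(\<lambda>w. f (z, w)) \<in> borel_measurable circle_haar" for z
    by (simp cong: measurable_cong_sets)
  define J where "J = (\<integral>\<^sup>+w. f (1, w) \<partial>circle_haar)"
  have inner: "(\<integral>\<^sup>+w. f (z, w) \<partial>\<mu>) \<le> ennreal C * J" if z: "z \<in> unit_circle" for z
  proof -
    have "(\<integral>\<^sup>+w. f (z, w) \<partial>\<mu>) = (\<integral>\<^sup>+w. ennreal (m w) * f (z, w) \<partial>circle_haar)"
    proof -
      have "\<mu> = density circle_haar (\<lambda>z. ennreal (m z))"
        using m by (simp add: smooth_density_def)
      then show ?thesis
        using nn_integral_density[of "\<lambda>z. ennreal (m z)" circle_haar "\<lambda>w. f (z, w)"] by simp
    qed
    also have "\<dots> \<le> (\<integral>\<^sup>+w. ennreal C * f (z, w) \<partial>circle_haar)"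
      using C by (intro nn_integral_mono mult_right_mono ennreal_leI) auto
    also have "\<dots> = ennreal C * (\<integral>\<^sup>+w. f (z, w) \<partial>circle_haar)"
      by (rule nn_integral_cmult) simp
    also have "(\<integral>\<^sup>+w. f (z, w) \<partial>circle_haar) = J"
      using nn_integral_haar_log_dist(1)[OF z] by (simp add: f_def J_def)
    finally show ?thesis .
  qed
  have "f \<in> borel_measurable (\<mu> \<Otimes>\<^sub>M \<mu>)"
    by (rule circle_prob_pair_measurable[OF \<mu>]) simp
  then have "(\<integral>\<^sup>+p. f p \<partial>(\<mu> \<Otimes>\<^sub>M \<mu>)) = (\<integral>\<^sup>+z. \<integral>\<^sup>+w. f (z, w) \<partial>\<mu> \<partial>\<mu>)"
    by (rule nn_integral_fst[symmetric])
  also have "\<dots> \<le> (\<integral>\<^sup>+z. ennreal C * J \<partial>\<mu>)"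
    using inner by (intro nn_integral_mono) (simp add: circle_prob_space[OF \<mu>])
  also have "\<dots> = ennreal C * J"
    by (simp add: emeasure_space_1)
  also have "\<dots> < \<infinity>"
    using nn_integral_haar_log_dist(2)[of 1]
    by (simp add: J_def f_def ennreal_mult_less_top)
  finally show ?thesis
    by (simp add: finite_log_energy_def f_def)
qed

section \<open>The Hilbert transform of a smooth density\<close>

text \<open>The truncated principal value in terms of the group structure: \<open>z * cnj w\<close>
  carries the difference of the angles, so no branch of \<open>Arg\<close> enters.\<close>

definition truncated_hilbert :: "complex measure \<Rightarrow> real \<Rightarrow> complex \<Rightarrow> real" where
  "truncated_hilbert \<mu> \<epsilon> z = (\<integral>w. cot_kernel \<epsilon> (z * cnj w) \<partial>\<mu>)"

lemma cot_kernel_mult_cnj_measurable [measurable]: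
  "(\<lambda>p. cot_kernel \<epsilon> (fst p * cnj (snd p))) \<in> borel_measurable (borel \<Otimes>\<^sub>M borel)"
proof -
  have [measurable]: "cnj \<in> borel_measurable borel"
    by (intro borel_measurable_continuous_onI continuous_intros)
  show ?thesis by measurable
qed

lemma truncated_hilbert_measurable:
  assumes \<mu>: "circle_prob \<mu>"
  shows "truncated_hilbert \<mu> \<epsilon> \<in> borel_measurable \<mu>"
proof -
  interpret prob_space \<mu> using \<mu> by (simp add: circle_prob_def)
  have "(\<lambda>p. cot_kernel \<epsilon> (fst p * cnj (snd p))) \<in> borel_measurable (\<mu> \<Otimes>\<^sub>M \<mu>)"
    by (rule circle_prob_pair_measurable[OF \<mu>]) simp
  then have "(\<lambda>z. \<integral>w. cot_kernel \<epsilon> (fst (z, w) * cnj (snd (z, w))) \<partial>\<mu>) \<in> borel_measurable \<mu>"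
    by (intro borel_measurable_lebesgue_integral) (simp add: case_prod_unfold)
  then show ?thesis
    by (simp add: truncated_hilbert_def[abs_def])
qed

text \<open>Conjugation preserves Haar measure and reverses the sign of the kernel. This
  cancellation is what makes the principal value converge.\<close>

lemma integral_cot_kernel_circle_haar: "(\<integral>v. cot_kernel \<epsilon> v \<partial>circle_haar) = 0"
proof -
  define f where "f t = indicator {-pi<..<pi} t / (2 * pi) * cot_kernel \<epsilon> (cis t)" for t
  have odd: "f (- t) = - f t" for t
    using cot_kernel_cnj[of \<epsilon> "cis t"] by (auto simp: f_def indicator_def cis_cnj)
  have eq: "(\<integral>v. cot_kernel \<epsilon> v \<partial>circle_haar) = (LINT t|lborel. f t)"
    unfolding f_def by (rule integral_circle_haar) (intro measurable_restrict_space1, simp)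
  also have "\<dots> = (LINT t|lborel. f (- t))"
    using lborel_integral_real_affine[of "-1" f 0] by simp
  also have "\<dots> = - (LINT t|lborel. f t)"
    by (simp add: odd)
  finally show ?thesis using eq by simp
qed

lemma smooth_density_lipschitz:
  assumes "smooth_density \<mu> m"
  obtains L where "0 \<le> L" "\<And>a b. \<bar>m (cis a) - m (cis b)\<bar> \<le> L * \<bar>a - b\<bar>"
proof -
  \<comment> \<open>The second derivative is taken only to have the first one continuous in the
    angle, hence bounded.\<close>
  have Ck: "circle_Ck 2 m"
    using assms by (simp add: smooth_density_def circle_smooth_def)
  have d: "((\<lambda>t. m (cis t)) has_real_derivative circle_deriv m (cis t)) (at t)" for t
    using circle_Ck_has_derivative[OF Ck, of 0] by simp
  have "((\<lambda>t. circle_deriv m (cis t)) has_real_derivative (circle_deriv ^^ 2) m (cis t)) (at t)" for t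
    using circle_Ck_has_derivative[OF Ck, of 1] by (simp add: numeral_2_eq_2)
  then have "continuous_on UNIV (\<lambda>t. circle_deriv m (cis t))"
    by (meson DERIV_continuous_on has_field_derivative_at_within)
  then obtain L where L: "0 \<le> L" "\<forall>z\<in>unit_circle. \<bar>circle_deriv m z\<bar> \<le> L"
    using circle_function_measurable_bounded(2) by blast
  have "norm (m (cis a) - m (cis b)) \<le> L * norm (a - b)" for a b
    by (rule field_differentiable_bound[where S = UNIV, OF _ has_field_derivative_at_within[OF d]])
       (use L in auto)
  then show thesis using that L(1) by simp
qed

text \<open>The substitution \<open>w = z * v\<close> moves \<open>z\<close> from the kernel to the
  density. It leaves the kernel at \<open>cnj v\<close>, whence the minus sign.\<close>

lemma truncated_hilbert_haar:
  assumes m: "smooth_density \<mu> m" and z: "z \<in> unit_circle"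
  shows "truncated_hilbert \<mu> \<epsilon> z = - (\<integral>v. cot_kernel \<epsilon> v * m (z * v) \<partial>circle_haar)"
proof -
  have [measurable]: "m \<in> borel_measurable circle_haar"
    using smooth_density_measurable[OF m] by (simp cong: measurable_cong_sets)
  have "(\<lambda>p. cot_kernel \<epsilon> (fst p * cnj (snd p))) \<in> borel_measurable (borel \<Otimes>\<^sub>M borel)"
    by simp
  from measurable_compose[OF _ this, of "\<lambda>w. (z, w)" borel]
  have "(\<lambda>w. cot_kernel \<epsilon> (z * cnj w)) \<in> borel_measurable borel"
    by simp
  then have K: "(\<lambda>w. cot_kernel \<epsilon> (z * cnj w)) \<in> borel_measurable circle_borel"
    by (rule measurable_restrict_space1)
  then have [measurable]: "(\<lambda>w. cot_kernel \<epsilon> (z * cnj w)) \<in> borel_measurable circle_haar"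
    by (simp cong: measurable_cong_sets)
  have ae: "AE w in circle_haar. 0 \<le> m w"
    using m by (intro AE_I2) (simp add: smooth_density_def)
  have "\<mu> = density circle_haar (\<lambda>z. ennreal (m z))"
    using m by (simp add: smooth_density_def)
  then have "truncated_hilbert \<mu> \<epsilon> z = (\<integral>w. m w * cot_kernel \<epsilon> (z * cnj w) \<partial>circle_haar)"
    unfolding truncated_hilbert_def
    using integral_density[of "\<lambda>w. cot_kernel \<epsilon> (z * cnj w)" circle_haar m] ae by simp
  also have "\<dots> = (\<integral>v. m (z * v) * cot_kernel \<epsilon> (z * cnj (z * v)) \<partial>circle_haar)"
    using K smooth_density_measurable[OF m]
    by (intro integral_circle_haar_rotation[OF z, symmetric]) simp
  also have "\<dots> = (\<integral>v. - (cot_kernel \<epsilon> v * m (z * v)) \<partial>circle_haar)"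
  proof (rule Bochner_Integration.integral_cong[OF refl])
    fix v
    have "z * cnj (z * v) = cnj v"
    proof -
      have "z * cnj z = 1" using z complex_norm_square[of z] by simp
      then show ?thesis by (simp add: mult.assoc[symmetric])
    qed
    then show "m (z * v) * cot_kernel \<epsilon> (z * cnj (z * v)) = - (cot_kernel \<epsilon> v * m (z * v))"
      by (simp only: cot_kernel_cnj) simp
  qed
  finally show ?thesis by simp
qed

text \<open>The kernel has integral 0, so the constant \<open>m z\<close> can be subtracted; the
  remaining increment vanishes linearly at the singularity.\<close>

lemma truncated_hilbert_regularized:
  assumes m: "smooth_density \<mu> m" and z: "z \<in> unit_circle" and e: "cos \<epsilon> < 1"
  shows "truncated_hilbert \<mu> \<epsilon> z = - (\<integral>v. cot_kernel \<epsilon> v * (m (z * v) - m z) \<partial>circle_haar)"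
proof -
  interpret H: prob_space circle_haar using circle_prob_haar by (simp add: circle_prob_def)
  have "continuous_on UNIV (\<lambda>t. m (cis t))"
    using smooth_density_continuous[OF m] by (rule continuous_on_compose2) (auto intro!: continuous_intros)
  then obtain C where C: "0 \<le> C" "\<And>z. z \<in> unit_circle \<Longrightarrow> \<bar>m z\<bar> \<le> C"
    using circle_function_measurable_bounded(2) by blast
  have mz: "(\<lambda>v. m (z * v)) \<in> borel_measurable circle_haar"
    using measurable_compose[OF rotation_measurable[OF z] smooth_density_measurable[OF m]]
    by (simp cong: measurable_cong_sets)
  have K: "cot_kernel \<epsilon> \<in> borel_measurable circle_haar"
    by (rule circle_prob_measurable(2)[OF circle_prob_haar]) simp
  have i1: "integrable circle_haar (\<lambda>v. cot_kernel \<epsilon> v * m (z * v))"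
  proof (rule H.integrable_const_bound[where B = "1 / (1 - cos \<epsilon>) * C"])
    show "AE v in circle_haar. norm (cot_kernel \<epsilon> v * m (z * v)) \<le> 1 / (1 - cos \<epsilon>) * C"
      using abs_cot_kernel_le[OF _ e] C z e
      by (intro AE_I2) (auto simp: abs_mult norm_mult simp del: times_divide_eq_left intro!: mult_mono)
  qed (use mz K in simp)
  have i2: "integrable circle_haar (\<lambda>v. cot_kernel \<epsilon> v * m z)"
  proof (rule H.integrable_const_bound[where B = "1 / (1 - cos \<epsilon>) * C"])
    show "AE v in circle_haar. norm (cot_kernel \<epsilon> v * m z) \<le> 1 / (1 - cos \<epsilon>) * C"
      using abs_cot_kernel_le[OF _ e] C z e
      by (intro AE_I2) (auto simp: abs_mult norm_mult simp del: times_divide_eq_left intro!: mult_mono)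
  qed (use K in simp)
  have "(\<integral>v. cot_kernel \<epsilon> v * (m (z * v) - m z) \<partial>circle_haar) =
      (\<integral>v. cot_kernel \<epsilon> v * m (z * v) \<partial>circle_haar) - (\<integral>v. cot_kernel \<epsilon> v * m z \<partial>circle_haar)"
    using i1 i2 by (simp add: right_diff_distrib)
  then show ?thesis
    using integral_cot_kernel_circle_haar[of \<epsilon>] truncated_hilbert_haar[OF m z, of \<epsilon>] by simp
qed

text \<open>The bound does not involve \<epsilon> and so serves as dominating constant when the
  truncation is removed.\<close>

lemma cot_kernel_increment_bound:
  assumes L: "0 \<le> L" "\<And>a b. \<bar>m (cis a) - m (cis b)\<bar> \<le> L * \<bar>a - b\<bar>"
    and z: "z \<in> unit_circle" and v: "v \<in> unit_circle"
  shows "\<bar>cot_kernel \<epsilon> v * (m (z * v) - m z)\<bar> \<le> 2 * L"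
proof -
  define x t where "x = Arg z" and "t = Arg v"
  have zx: "z = cis x" and vt: "v = cis t" and t: "\<bar>t\<bar> \<le> pi"
    using cis_Arg_circle[OF z] cis_Arg_circle[OF v] Arg_bounded[of v] by (auto simp: x_def t_def abs_le_iff)
  have "\<bar>cot_kernel \<epsilon> v * (m (z * v) - m z)\<bar> = \<bar>cot_kernel \<epsilon> (cis t)\<bar> * \<bar>m (cis (x + t)) - m (cis x)\<bar>"
    by (simp add: zx vt abs_mult cis_mult)
  also have "\<dots> \<le> \<bar>cot (t / 2)\<bar> * (L * \<bar>t\<bar>)"
    using L(2)[of "x + t" x] by (intro mult_mono) (auto simp: cot_kernel_cis)
  also have "\<dots> = L * \<bar>cot (t / 2) * t\<bar>"
    by (simp add: abs_mult)
  also have "\<dots> \<le> L * 2"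
    using abs_cot_half_mult_le[OF t] L(1) by (intro mult_left_mono)
  finally show ?thesis by simp
qed

lemma truncated_hilbert_bounded:
  assumes "smooth_density \<mu> m"
  obtains C where "0 \<le> C" "\<And>\<epsilon> z. cos \<epsilon> < 1 \<Longrightarrow> z \<in> unit_circle \<Longrightarrow> \<bar>truncated_hilbert \<mu> \<epsilon> z\<bar> \<le> C"
proof -
  interpret H: prob_space circle_haar using circle_prob_haar by (simp add: circle_prob_def)
  obtain L where L: "0 \<le> L" "\<And>a b. \<bar>m (cis a) - m (cis b)\<bar> \<le> L * \<bar>a - b\<bar>"
    using smooth_density_lipschitz[OF assms] by blast
  have "\<bar>truncated_hilbert \<mu> \<epsilon> z\<bar> \<le> 2 * L" if "cos \<epsilon> < 1" "z \<in> unit_circle" for \<epsilon> z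
  proof -
    have "(\<lambda>v. m (z * v)) \<in> borel_measurable circle_haar"
      using measurable_compose[OF rotation_measurable[OF that(2)] smooth_density_measurable[OF assms]]
      by (simp cong: measurable_cong_sets)
    moreover have "cot_kernel \<epsilon> \<in> borel_measurable circle_haar"
      by (rule circle_prob_measurable(2)[OF circle_prob_haar]) simp
    ultimately have i: "integrable circle_haar (\<lambda>v. cot_kernel \<epsilon> v * (m (z * v) - m z))"
      using cot_kernel_increment_bound[OF L that(2)]
      by (intro H.integrable_const_bound[where B = "2 * L"] AE_I2) auto
    have "\<bar>truncated_hilbert \<mu> \<epsilon> z\<bar> = norm (\<integral>v. cot_kernel \<epsilon> v * (m (z * v) - m z) \<partial>circle_haar)"
      using truncated_hilbert_regularized[OF assms that(2,1)] by simp
    also have "\<dots> \<le> (\<integral>v. 2 * L \<partial>circle_haar)"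
      using cot_kernel_increment_bound[OF L that(2)] by (intro Bochner_Integration.integral_norm_bound_integral i) auto
    also have "\<dots> = 2 * L"
      using H.prob_space by simp
    finally show ?thesis .
  qed
  then show thesis using that L(1) by (meson mult_nonneg_nonneg zero_le_numeral)
qed

text \<open>This links the group form to the integral in the definition of
  \<open>circle_hilbert\<close>, whose range is the period centred at \<open>Arg z\<close>; with
  \<open>y = Arg z + t\<close> the cotangent is taken at \<open>- t / 2\<close>, which absorbs the
  minus sign.\<close>

lemma truncated_hilbert_line:
  assumes m: "smooth_density \<mu> m" and z: "z \<in> unit_circle" and e: "0 < \<epsilon>" "\<epsilon> < pi"
  shows "truncated_hilbert \<mu> \<epsilon> z =
    (LINT y:{y. \<epsilon> < \<bar>Arg z - y\<bar> \<and> \<bar>Arg z - y\<bar> \<le> pi}|lborel. cot ((Arg z - y) / 2) * m (cis y) / (2 * pi))"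
    (is "_ = (LINT y:?S|lborel. ?f y)")
proof -
  define x where "x = Arg z"
  have zx: "z = cis x" using cis_Arg_circle[OF z] by (simp add: x_def)
  have mz: "(\<lambda>v. cot_kernel \<epsilon> v * m (z * v)) \<in> borel_measurable circle_borel"
    using measurable_compose[OF rotation_measurable[OF z] smooth_density_measurable[OF m]]
    by (intro borel_measurable_times) (auto intro: measurable_restrict_space1)
  have "truncated_hilbert \<mu> \<epsilon> z =
     - (LINT t|lborel. indicator {-pi<..<pi} t / (2 * pi) * (cot_kernel \<epsilon> (cis t) * m (z * cis t)))"
    unfolding truncated_hilbert_haar[OF m z] by (subst integral_circle_haar[OF mz]) simp
  also have "\<dots> = (LINT t|lborel. indicator ?S (x + t) * ?f (x + t))"
    unfolding integral_minus[symmetric]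
  proof (rule Bochner_Integration.integral_cong[OF refl])
    fix t :: real
    have zt: "z * cis t = cis (x + t)"
      by (simp add: zx cis_mult)
    consider "\<bar>t\<bar> < pi" | "\<bar>t\<bar> = pi" | "\<bar>t\<bar> > pi" by linarith
    then show "- (indicator {-pi<..<pi} t / (2 * pi) * (cot_kernel \<epsilon> (cis t) * m (z * cis t))) =
       indicator ?S (x + t) * ?f (x + t)"
    proof cases
      case 1
      then show ?thesis
        using cos_less_cos_iff[of t \<epsilon>] e
        by (auto simp: cot_kernel_cis zt x_def[symmetric] indicator_def abs_less_iff)
    next
      \<comment> \<open>The range on the line contains these endpoints and the open interval does
        not, but the cotangent vanishes at \<open>pi / 2\<close>.\<close>
      case 2
      then have "t = pi \<or> t = - pi" by linarith
      then show ?thesis by (auto simp: x_def[symmetric] cot_def)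
    next
      case 3
      then show ?thesis by (auto simp: x_def[symmetric] indicator_def)
    qed
  qed
  also have "\<dots> = (LINT y|lborel. indicator ?S y * ?f y)"
    using lborel_integral_real_affine[of 1 "\<lambda>y. indicator ?S y * ?f y" x] by simp
  finally show ?thesis
    by (simp add: set_lebesgue_integral_def)
qed

section \<open>Removing the truncation of the Hilbert transform\<close>

lemma tendsto_cot_kernel:
  assumes "S \<longlonglongrightarrow> 0" "\<And>n. 0 < S n" and v: "v \<in> unit_circle"
  shows "(\<lambda>n. cot_kernel (S n) v) \<longlonglongrightarrow> Im v / (1 - Re v)"
proof (cases "v = 1")
  \<comment> \<open>At the singularity the claimed limit is 0/0, that is 0, and every truncated
    kernel is 0 there too.\<close>
  case True
  then show ?thesis by (simp add: cot_kernel_def cong: if_cong)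
next
  case False
  have "Re v \<le> 1" using v complex_Re_le_cmod[of v] by simp
  moreover have "Re v \<noteq> 1"
    using v False by (auto simp: complex_eq_iff cmod_def)
  ultimately have "Re v < cos 0" by simp
  moreover have "(\<lambda>n. cos (S n)) \<longlonglongrightarrow> cos 0"
    using assms(1) by (rule tendsto_cos)
  ultimately have "eventually (\<lambda>n. Re v < cos (S n)) sequentially"
    using order_tendstoD(1) by blast
  then have "eventually (\<lambda>n. cot_kernel (S n) v = Im v / (1 - Re v)) sequentially"
    by eventually_elim (simp add: cot_kernel_def)
  then show ?thesis
    by (simp add: tendsto_eventually)
qed

lemma cos_less_1: "0 < \<epsilon> \<Longrightarrow> \<epsilon> < pi \<Longrightarrow> cos \<epsilon> < 1"
  using cos_mono_less_eq[of \<epsilon> 0] by simp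

text \<open>A \<open>Lim\<close> carries information only once convergence is known. Dominated
  convergence of the regularized integral supplies it and identifies the value.\<close>

lemma truncated_hilbert_tendsto:
  assumes sm: "smooth_circle_measure \<mu>" and z: "z \<in> unit_circle"
  shows "((\<lambda>\<epsilon>. truncated_hilbert \<mu> \<epsilon> z) \<longlongrightarrow> circle_hilbert \<mu> z) (at_right 0)"
proof -
  interpret H: prob_space circle_haar using circle_prob_haar by (simp add: circle_prob_def)
  \<comment> \<open>The density must be the chosen one, since \<open>circle_hilbert\<close> refers
    to it.\<close>
  define m where "m = circle_density \<mu>"
  have m: "smooth_density \<mu> m"
    using sm unfolding m_def circle_density_def smooth_circle_measure_def by (rule someI_ex)
  obtain L where L: "0 \<le> L" "\<And>a b. \<bar>m (cis a) - m (cis b)\<bar> \<le> L * \<bar>a - b\<bar>"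
    using smooth_density_lipschitz[OF m] by blast
  define h where "h = - (\<integral>v. Im v / (1 - Re v) * (m (z * v) - m z) \<partial>circle_haar)"
  have mz [measurable]: "(\<lambda>v. m (z * v)) \<in> borel_measurable circle_haar"
    using measurable_compose[OF rotation_measurable[OF z] smooth_density_measurable[OF m]]
    by (simp cong: measurable_cong_sets)
  have [measurable]: "(\<lambda>v. Im v / (1 - Re v)) \<in> borel_measurable circle_haar"
    "cot_kernel \<epsilon> \<in> borel_measurable circle_haar" for \<epsilon>
    by (rule circle_prob_measurable(2)[OF circle_prob_haar], simp)+
  have lim: "((\<lambda>\<epsilon>. truncated_hilbert \<mu> \<epsilon> z) \<longlongrightarrow> h) (at_right 0)"
  proof (rule tendsto_at_right_sequentially[OF pi_gt_zero])
    fix S :: "nat \<Rightarrow> real"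
    assume S: "\<And>n. 0 < S n" "\<And>n. S n < pi" "S \<longlonglongrightarrow> 0"
    have "(\<lambda>n. \<integral>v. cot_kernel (S n) v * (m (z * v) - m z) \<partial>circle_haar)
      \<longlonglongrightarrow> (\<integral>v. Im v / (1 - Re v) * (m (z * v) - m z) \<partial>circle_haar)"
    proof (rule integral_dominated_convergence[where w = "\<lambda>_. 2 * L"])
      show "(\<lambda>v. Im v / (1 - Re v) * (m (z * v) - m z)) \<in> borel_measurable circle_haar"
        by measurable
      show "(\<lambda>v. cot_kernel (S n) v * (m (z * v) - m z)) \<in> borel_measurable circle_haar" for n
        by measurable
      show "AE v in circle_haar. (\<lambda>n. cot_kernel (S n) v * (m (z * v) - m z))
          \<longlonglongrightarrow> Im v / (1 - Re v) * (m (z * v) - m z)"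
        using S by (intro AE_I2 tendsto_mult tendsto_cot_kernel tendsto_const) auto
      show "AE v in circle_haar. norm (cot_kernel (S n) v * (m (z * v) - m z)) \<le> 2 * L" for n
        using cot_kernel_increment_bound[OF L z] by (intro AE_I2) simp
    qed simp
    then show "(\<lambda>n. truncated_hilbert \<mu> (S n) z) \<longlonglongrightarrow> h"
      using truncated_hilbert_regularized[OF m z cos_less_1[OF S(1,2)]]
      by (simp add: h_def tendsto_minus)
  qed
  have "eventually (\<lambda>\<epsilon>. \<epsilon> \<in> {0<..<pi}) (at_right 0)"
    by (rule eventually_at_right_real) simp
  then have "eventually (\<lambda>\<epsilon>. truncated_hilbert \<mu> \<epsilon> z =
    (LINT y:{y. \<epsilon> < \<bar>Arg z - y\<bar> \<and> \<bar>Arg z - y\<bar> \<le> pi}|lborel.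
      cot ((Arg z - y) / 2) * m (cis y) / (2 * pi))) (at_right 0)"
    by eventually_elim (rule truncated_hilbert_line[OF m z], auto)
  from Lim_transform_eventually[OF lim this] have "circle_hilbert \<mu> z = h"
    unfolding circle_hilbert_def Let_def m_def by (intro tendsto_Lim) simp_all
  with lim show ?thesis by simp
qed

section \<open>Quantile functions on the circle\<close>

abbreviation unit_interval :: "real measure" where
  "unit_interval \<equiv> restrict_space lborel {0<..<1}"

lemma prob_space_unit_interval: "prob_space unit_interval"
  by (auto simp: emeasure_restrict_space space_restrict_space intro!: prob_spaceI)

text \<open>The generalized inverse of the distribution function. The range condition holds at every
  point of the open interval: were \<open>I p\<close> below \<open>c\<close>, the half-line up to
  it, of mass at least \<open>p\<close>, would be disjoint from a set of full mass.\<close>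

lemma quantile_function:
  assumes M: "real_distribution M" and cd: "measure M {c..d} = 1"
  obtains a where "mono_on {0<..<1} a" "a \<in> borel_measurable unit_interval"
    "distr unit_interval borel a = M" "\<And>p. p \<in> {0<..<1} \<Longrightarrow> a p \<in> {c..d}"
proof -
  interpret cdf_distribution M
    using M by (simp add: cdf_distribution_def)
  have range: "I p \<in> {c..d}" if p: "p \<in> {0<..<1}" for p
  proof -
    have "measure M {c..d} \<le> C d"
      unfolding cdf_def by (intro finite_measure_mono) auto
    then have "p \<le> C d" using cd p by simp
    then have le: "I p \<le> d" using pseudoinverse' p by blast
    have "p \<le> C (I p)" using pseudoinverse' p by blast
    with p have pos: "0 < C (I p)" by simp
    have "c \<le> I p"
    proof (rule ccontr)
      assume "\<not> c \<le> I p"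
      then have "{..I p} \<inter> {c..d} = {}" by auto
      then have "measure M ({..I p} \<union> {c..d}) = C (I p) + 1"
        using finite_measure_Union[of "{..I p}" "{c..d}"] cd by (simp add: cdf_def)
      moreover have "measure M ({..I p} \<union> {c..d}) \<le> 1" by simp
      ultimately show False using pos by simp
    qed
    with le show ?thesis by simp
  qed
  have "I \<in> borel_measurable unit_interval"
    using measurable_CI by (simp cong: measurable_cong_sets add: sets_restrict_space_cong[of borel lborel])
  from that[OF mono_I this distr_I_eq_M range] show thesis .
qed

text \<open>\<open>A\<close> is any measurable choice of angle. The law of \<open>A\<close> on the
  line is rearranged monotonically, which changes neither the law on the circle nor the mean, so the
  mean can be computed and adjusted through \<open>A\<close>.\<close>

lemma circle_quantile_function:
  assumes \<kappa>: "circle_prob \<kappa>" and A: "A \<in> borel_measurable borel"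
    and range: "\<And>z. z \<in> unit_circle \<Longrightarrow> cis (A z) = z \<and> c \<le> A z \<and> A z \<le> d"
  obtains a where "mono_on {0<..<1} a" "a \<in> borel_measurable unit_interval"
    "distr unit_interval circle_borel (\<lambda>p. cis (a p)) = \<kappa>"
    "\<And>p. p \<in> {0<..<1} \<Longrightarrow> a p \<in> {c..d}"
    "(\<integral>p. a p \<partial>unit_interval) = (\<integral>z. A z \<partial>\<kappa>)"
proof -
  interpret prob_space \<kappa> using \<kappa> by (simp add: circle_prob_def)
  have A\<kappa>: "A \<in> borel_measurable \<kappa>"
    by (rule circle_prob_measurable(2)[OF \<kappa> A])
  have "real_distribution (distr \<kappa> borel A)"
    using A\<kappa> by (rule real_distribution_distr)
  moreover have "measure (distr \<kappa> borel A) {c..d} = 1"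
  proof -
    have "A -` {c..d} \<inter> space \<kappa> = space \<kappa>"
      using range by (auto simp: circle_prob_space[OF \<kappa>])
    then show ?thesis
      using A\<kappa> prob_space by (simp add: measure_distr)
  qed
  ultimately obtain a where a: "mono_on {0<..<1} a" "a \<in> borel_measurable unit_interval"
    "distr unit_interval borel a = distr \<kappa> borel A" "\<And>p. p \<in> {0<..<1} \<Longrightarrow> a p \<in> {c..d}"
    using quantile_function by blast
  have "distr unit_interval circle_borel (\<lambda>p. cis (a p)) = distr (distr unit_interval borel a) circle_borel cis"
    using distr_distr[OF cis_measurable_circle a(2)] by (simp add: comp_def)
  also have "\<dots> = distr \<kappa> circle_borel (\<lambda>z. cis (A z))"
    unfolding a(3) using distr_distr[OF cis_measurable_circle A\<kappa>] by (simp add: comp_def)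
  also have "\<dots> = distr \<kappa> \<kappa> (\<lambda>z. z)"
    using \<kappa> range by (intro distr_cong) (auto simp: circle_prob_def circle_prob_space[OF \<kappa>])
  also have "\<dots> = \<kappa>" by (rule distr_id)
  finally have law: "distr unit_interval circle_borel (\<lambda>p. cis (a p)) = \<kappa>" .
  have "(\<integral>p. a p \<partial>unit_interval) = (\<integral>x. x \<partial>distr unit_interval borel a)"
    using a(2) by (simp add: integral_distr)
  also have "\<dots> = (\<integral>z. A z \<partial>\<kappa>)"
    unfolding a(3) using A\<kappa> by (simp add: integral_distr)
  finally show thesis using that a law by blast
qed

text \<open>An atom would give the diagonal positive mass under the product measure.\<close>

lemma finite_log_energy_no_atoms:
  assumes \<kappa>: "circle_prob \<kappa>" and fin: "finite_log_energy \<kappa>" and z: "z \<in> unit_circle"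
  shows "measure \<kappa> {z} = 0"
proof -
  interpret prob_space \<kappa> using \<kappa> by (simp add: circle_prob_def)
  have zs: "{z} \<in> sets \<kappa>"
    using \<kappa> z by (auto simp: circle_prob_def sets_restrict_space_iff)
  have "AE p in \<kappa> \<Otimes>\<^sub>M \<kappa>. \<not> p \<in> {z} \<times> {z}"
    using finite_log_energy_facts(1)[OF \<kappa> fin] by eventually_elim auto
  then have "emeasure (\<kappa> \<Otimes>\<^sub>M \<kappa>) {p \<in> space (\<kappa> \<Otimes>\<^sub>M \<kappa>). p \<in> {z} \<times> {z}} = 0"
    by (rule emeasure_eq_0_AE)
  also have "{p \<in> space (\<kappa> \<Otimes>\<^sub>M \<kappa>). p \<in> {z} \<times> {z}} = {z} \<times> {z}"
    using z by (auto simp: space_pair_measure circle_prob_space[OF \<kappa>])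
  finally have "emeasure \<kappa> {z} * emeasure \<kappa> {z} = 0"
    by (simp only: emeasure_pair_measure_Times[OF zs zs])
  then show ?thesis by (simp add: emeasure_eq_measure)
qed

text \<open>Cutting the circle at \<open>cis \<theta>\<close> rather than at \<open>-1\<close> raises the mean angle continuously in \<open>\<theta>\<close>,
  by \<open>2 * pi\<close> in total, because there are no atoms; together with full turns every mean is reached.\<close>

lemma circle_quantile_function_with_mean:
  assumes \<kappa>: "circle_prob \<kappa>" and fin: "finite_log_energy \<kappa>"
  obtains b c where "mono_on {0<..<1} b" "b \<in> borel_measurable unit_interval"
    "distr unit_interval circle_borel (\<lambda>p. cis (b p)) = \<kappa>"
    "\<And>p. p \<in> {0<..<1} \<Longrightarrow> b p \<in> {c..c + 2 * pi}"
    "(\<integral>p. b p \<partial>unit_interval) = v"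
proof -
  interpret prob_space \<kappa> using \<kappa> by (simp add: circle_prob_def)
  have Arg_meas [measurable]: "Arg \<in> borel_measurable \<kappa>"
    by (rule circle_prob_measurable(2)[OF \<kappa>]) simp
  define F where "F = cdf (distr \<kappa> borel Arg)"
  interpret D: real_distribution "distr \<kappa> borel Arg"
    using Arg_meas by (rule real_distribution_distr)
  have F_eq: "F \<theta> = measure \<kappa> {z \<in> space \<kappa>. Arg z \<le> \<theta>}" for \<theta>
    by (simp add: F_def cdf_def measure_distr vimage_def Int_def conj_commute)
  have "measure (distr \<kappa> borel Arg) {x} = 0" for x
  proof -
    have "measure (distr \<kappa> borel Arg) {x} = measure \<kappa> (Arg -` {x} \<inter> space \<kappa>)"
      by (simp add: measure_distr)
    also have "\<dots> \<le> measure \<kappa> {cis x}"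
    proof (rule finite_measure_mono)
      show "Arg -` {x} \<inter> space \<kappa> \<subseteq> {cis x}"
        using cis_Arg_circle by (auto simp: circle_prob_space[OF \<kappa>])
      show "{cis x} \<in> sets \<kappa>"
        using \<kappa> by (auto simp: circle_prob_def sets_restrict_space_iff)
    qed
    also have "\<dots> = 0"
      by (rule finite_log_energy_no_atoms[OF \<kappa> fin]) simp
    finally show ?thesis by (simp add: measure_le_0_iff)
  qed
  then have cont: "isCont F x" for x
    unfolding F_def D.isCont_cdf by simp
  have F_ends: "F (- pi) = 0" "F pi = 1"
  proof -
    have "{z \<in> space \<kappa>. Arg z \<le> - pi} = {}" "{z \<in> space \<kappa>. Arg z \<le> pi} = space \<kappa>"
      using Arg_bounded by (auto simp: not_le)
    then show "F (- pi) = 0" "F pi = 1"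
      by (simp_all only: F_eq prob_space measure_empty)
  qed
  \<comment> \<open>The missing mean, counted in turns. The fractional part is obtained by turning a
    subset of mass \<open>frac w\<close> once, the integer part by turning the whole circle.\<close>
  define w where "w = (v - (\<integral>z. Arg z \<partial>\<kappa>)) / (2 * pi)"
  have "0 \<le> frac w" "frac w \<le> 1"
    using frac_lt_1[of w] by auto
  then obtain \<theta> where \<theta>: "- pi \<le> \<theta>" "\<theta> \<le> pi" "F \<theta> = frac w"
    using IVT[of F "- pi" "frac w" pi] F_ends cont by auto
  \<comment> \<open>Points with \<open>Arg z\<close> up to \<open>\<theta>\<close> receive one extra
    turn. They land above the others, so all values still lie in one period, now starting at
    \<open>\<theta>\<close> up to full turns.\<close>
  define A where "A z = Arg z + 2 * pi * (indicator {z. Arg z \<le> \<theta>} z + of_int \<lfloor>w\<rfloor>)" for z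
  have A_meas: "A \<in> borel_measurable borel"
    unfolding A_def by measurable
  define c where "c = \<theta> + 2 * pi * of_int \<lfloor>w\<rfloor>"
  have A: "cis (A z) = z \<and> c \<le> A z \<and> A z \<le> c + 2 * pi" if z: "z \<in> unit_circle" for z
  proof -
    have turn: "cis (2 * pi * (indicator {z. Arg z \<le> \<theta>} z + of_int \<lfloor>w\<rfloor>)) = 1"
      using cis_multiple_2pi[of "indicator {z. Arg z \<le> \<theta>} z + of_int \<lfloor>w\<rfloor>"]
      by (auto simp: indicator_def)
    have "cis (A z) = z"
      unfolding A_def cis_mult[symmetric] turn using cis_Arg_circle[OF z] by simp
    moreover have "c \<le> A z \<and> A z \<le> c + 2 * pi"
      using Arg_bounded[of z] \<theta> by (auto simp: A_def c_def indicator_def ring_distribs)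
    ultimately show ?thesis by simp
  qed
  have Arg_int: "integrable \<kappa> Arg"
    using Arg_bounded by (intro integrable_const_bound[where B = pi] AE_I2) (auto simp: abs_le_iff less_imp_le minus_le_iff)
  have ind: "integrable \<kappa> (indicator {z. Arg z \<le> \<theta>} :: complex \<Rightarrow> real)"
    "(\<integral>z. indicator {z. Arg z \<le> \<theta>} z \<partial>\<kappa>) = F \<theta>"
  proof -
    have *: "(indicator {z. Arg z \<le> \<theta>} z :: real) = indicator {z \<in> space \<kappa>. Arg z \<le> \<theta>} z" if "z \<in> space \<kappa>" for z
      using that by (simp add: indicator_def)
    show "integrable \<kappa> (indicator {z. Arg z \<le> \<theta>} :: complex \<Rightarrow> real)"
      by (subst Bochner_Integration.integrable_cong[OF refl *]) (auto simp: less_top[symmetric])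
    show "(\<integral>z. indicator {z. Arg z \<le> \<theta>} z \<partial>\<kappa>) = F \<theta>"
      by (subst Bochner_Integration.integral_cong[OF refl *]) (auto simp: F_eq)
  qed
  have "(\<integral>z. A z \<partial>\<kappa>) = (\<integral>z. Arg z \<partial>\<kappa>) + 2 * pi * (F \<theta> + of_int \<lfloor>w\<rfloor>)"
    unfolding A_def using Arg_int ind by (simp add: prob_space)
  also have "\<dots> = v"
    using \<theta>(3) by (simp add: frac_def w_def)
  finally have mean: "(\<integral>z. A z \<partial>\<kappa>) = v" .
  obtain b where "mono_on {0<..<1} b" "b \<in> borel_measurable unit_interval"
    "distr unit_interval circle_borel (\<lambda>p. cis (b p)) = \<kappa>"
    "\<And>p. p \<in> {0<..<1} \<Longrightarrow> b p \<in> {c..c + 2 * pi}"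
    "(\<integral>p. b p \<partial>unit_interval) = (\<integral>z. A z \<partial>\<kappa>)"
    using circle_quantile_function[OF \<kappa> A_meas A] by blast
  then show thesis using that mean by blast
qed

section \<open>Pushing the energies forward to the unit interval\<close>

text \<open>The equal-sign condition puts \<open>A\<close> and \<open>B\<close> between the same two
  zeros of the sine, where the convexity estimate applies. Changing both signs at once leaves the
  inequality unchanged, which settles the negative case; nonvanishing sines exclude the
  endpoints.\<close>

lemma pair_log_inequality:
  fixes A B :: real
  assumes "\<bar>A\<bar> \<le> 2 * pi" "\<bar>B\<bar> \<le> 2 * pi" "0 \<le> A \<and> 0 \<le> B \<or> A \<le> 0 \<and> B \<le> 0"
    and "sin (A / 2) \<noteq> 0" "sin (B / 2) \<noteq> 0"
  shows "ln (2 * \<bar>sin (B / 2)\<bar>) \<le>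
    ln (2 * \<bar>sin (A / 2)\<bar>) + cot (A / 2) * (B - A) / 2 - (B - A)\<^sup>2 / 8"
proof -
  have pos: "ln (2 * \<bar>sin (B / 2)\<bar>) \<le>
      ln (2 * \<bar>sin (A / 2)\<bar>) + cot (A / 2) * (B - A) / 2 - (B - A)\<^sup>2 / 8"
    if "0 \<le> A" "A \<le> 2 * pi" "0 \<le> B" "B \<le> 2 * pi" "sin (A / 2) \<noteq> 0" "sin (B / 2) \<noteq> 0" for A B :: real
  proof -
    have "A \<noteq> 0 \<and> A \<noteq> 2 * pi \<and> B \<noteq> 0 \<and> B \<noteq> 2 * pi"
      using that(5,6) by auto
    with that have AB: "0 < A" "A < 2 * pi" "0 < B" "B < 2 * pi" by auto
    then have "0 < sin (A / 2)" "0 < sin (B / 2)"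
      by (auto intro!: sin_gt_zero)
    with ln_sin_half_second_order[OF AB] show ?thesis by simp
  qed
  show ?thesis
  proof (cases "0 \<le> A \<and> 0 \<le> B")
    case True
    then show ?thesis using pos[of A B] assms by auto
  next
    case False
    then show ?thesis using pos[of "-A" "-B"] assms
      by (auto simp: power2_commute[of A] algebra_simps)
  qed
qed

lemma circle_pushforward_pair:
  assumes \<kappa>: "circle_prob \<kappa>" and fin: "finite_log_energy \<kappa>"
    and a: "a \<in> borel_measurable unit_interval"
    and law: "distr unit_interval circle_borel (\<lambda>p. cis (a p)) = \<kappa>"
  shows "AE p in unit_interval \<Otimes>\<^sub>M unit_interval. cis (a (fst p)) \<noteq> cis (a (snd p))"
    and "integrable (unit_interval \<Otimes>\<^sub>M unit_interval)
      (\<lambda>p. ln (norm (cis (a (fst p)) - cis (a (snd p)))))"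
    and "(\<integral>p. ln (norm (cis (a (fst p)) - cis (a (snd p)))) \<partial>(unit_interval \<Otimes>\<^sub>M unit_interval)) =
      (\<integral>p. ln (norm (fst p - snd p)) \<partial>(\<kappa> \<Otimes>\<^sub>M \<kappa>))"
proof -
  let ?c = "\<lambda>p. cis (a p)"
  let ?cc = "\<lambda>p. (?c (fst p), ?c (snd p))"
  interpret K: prob_space \<kappa> using \<kappa> by (simp add: circle_prob_def)
  have c: "?c \<in> measurable unit_interval circle_borel"
    using measurable_compose[OF a cis_measurable_circle] .
  have "sigma_finite_measure (distr unit_interval circle_borel ?c)"
    unfolding law by unfold_locales
  from pair_measure_distr[OF c c this]
  have eq: "\<kappa> \<Otimes>\<^sub>M \<kappa> = distr (unit_interval \<Otimes>\<^sub>M unit_interval) (circle_borel \<Otimes>\<^sub>M circle_borel) ?cc"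
    by (simp add: law case_prod_unfold)
  have cc: "?cc \<in> measurable (unit_interval \<Otimes>\<^sub>M unit_interval) (circle_borel \<Otimes>\<^sub>M circle_borel)"
    using c by measurable
  have sets: "sets (\<kappa> \<Otimes>\<^sub>M \<kappa>) = sets (circle_borel \<Otimes>\<^sub>M circle_borel)"
    using \<kappa> by (intro sets_pair_measure_cong) (auto simp: circle_prob_def)
  have "(\<lambda>p. ln (norm (fst p - snd p))) \<in> borel_measurable (\<kappa> \<Otimes>\<^sub>M \<kappa>)"
    by (rule circle_prob_pair_measurable[OF \<kappa>]) simp
  then have m: "(\<lambda>p. ln (norm (fst p - snd p))) \<in> borel_measurable (circle_borel \<Otimes>\<^sub>M circle_borel)"
    unfolding measurable_cong_sets[OF sets refl] .
  have "Measurable.pred (\<kappa> \<Otimes>\<^sub>M \<kappa>) (\<lambda>p. fst p \<noteq> snd p)"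
    by (rule circle_prob_pair_measurable[OF \<kappa>]) simp
  then have pred: "Measurable.pred (circle_borel \<Otimes>\<^sub>M circle_borel) (\<lambda>p. fst p \<noteq> snd p)"
    unfolding measurable_cong_sets[OF sets refl] .
  have "AE p in distr (unit_interval \<Otimes>\<^sub>M unit_interval) (circle_borel \<Otimes>\<^sub>M circle_borel) ?cc. fst p \<noteq> snd p"
    using finite_log_energy_facts(1)[OF \<kappa> fin] unfolding eq .
  then show "AE p in unit_interval \<Otimes>\<^sub>M unit_interval. cis (a (fst p)) \<noteq> cis (a (snd p))"
    using pred by (subst (asm) AE_distr_iff[OF cc]) (auto simp: pred_def)
  have "integrable (distr (unit_interval \<Otimes>\<^sub>M unit_interval) (circle_borel \<Otimes>\<^sub>M circle_borel) ?cc)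
      (\<lambda>p. ln (norm (fst p - snd p)))"
    using finite_log_energy_facts(2)[OF \<kappa> fin] unfolding eq .
  then show "integrable (unit_interval \<Otimes>\<^sub>M unit_interval)
      (\<lambda>p. ln (norm (cis (a (fst p)) - cis (a (snd p)))))"
    by (subst (asm) integrable_distr_eq[OF cc m]) simp
  show "(\<integral>p. ln (norm (cis (a (fst p)) - cis (a (snd p)))) \<partial>(unit_interval \<Otimes>\<^sub>M unit_interval)) =
      (\<integral>p. ln (norm (fst p - snd p)) \<partial>(\<kappa> \<Otimes>\<^sub>M \<kappa>))"
    unfolding eq by (subst integral_distr[OF cc m]) simp
qed

lemma circle_pushforward_integral:
  fixes f :: "complex \<Rightarrow> real"
  assumes a: "a \<in> borel_measurable unit_interval"
    and law: "distr unit_interval circle_borel (\<lambda>p. cis (a p)) = \<kappa>"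
    and f: "f \<in> borel_measurable circle_borel"
  shows "(\<lambda>p. f (cis (a p))) \<in> borel_measurable unit_interval"
    and "(\<integral>p. f (cis (a p)) \<partial>unit_interval) = (\<integral>z. f z \<partial>\<kappa>)"
proof -
  have c: "(\<lambda>p. cis (a p)) \<in> measurable unit_interval circle_borel"
    using measurable_compose[OF a cis_measurable_circle] .
  show "(\<lambda>p. f (cis (a p))) \<in> borel_measurable unit_interval"
    using measurable_compose[OF c f] .
  show "(\<integral>p. f (cis (a p)) \<partial>unit_interval) = (\<integral>z. f z \<partial>\<kappa>)"
    unfolding law[symmetric] by (rule integral_distr[OF c f, symmetric])
qed

text \<open>The value is twice the variance: here the mean of \<open>u\<close> drops out of the
  interaction term.\<close>

lemma integral_pair_difference_square:
  assumes "prob_space M" and u [measurable]: "u \<in> borel_measurable M"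
    and bound: "\<And>p. p \<in> space M \<Longrightarrow> \<bar>u p\<bar> \<le> (C :: real)"
  shows "(\<integral>p. (u (fst p) - u (snd p))\<^sup>2 \<partial>(M \<Otimes>\<^sub>M M)) =
    2 * (\<integral>p. (u p)\<^sup>2 \<partial>M) - 2 * (\<integral>p. u p \<partial>M)\<^sup>2"
proof -
  interpret prob_space M by fact
  interpret P: pair_prob_space M M ..
  have sq: "x\<^sup>2 \<le> D\<^sup>2" if "\<bar>x\<bar> \<le> D" for x D :: real
    using that abs_le_square_iff[of x D] by linarith
  have i: "integrable M u" "integrable M (\<lambda>p. (u p)\<^sup>2)"
    using bound by (intro integrable_const_bound[where B = C] AE_I2, simp_all)
      (intro integrable_const_bound[where B = "C\<^sup>2"] AE_I2, simp_all add: sq)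
  have bound2: "(u (fst p) - u (snd p))\<^sup>2 \<le> (2 * C)\<^sup>2" if "p \<in> space (M \<Otimes>\<^sub>M M)" for p
  proof -
    have "\<bar>u (fst p) - u (snd p)\<bar> \<le> 2 * C"
      using that bound[of "fst p"] bound[of "snd p"] by (auto simp: space_pair_measure)
    then show ?thesis by (rule sq)
  qed
  have int: "integrable (M \<Otimes>\<^sub>M M) (\<lambda>(p, q). (u p - u q)\<^sup>2)"
    using bound2 by (intro P.P.integrable_const_bound[where B = "(2 * C)\<^sup>2"] AE_I2) (auto simp: case_prod_unfold)
  have "(\<integral>p. (u (fst p) - u (snd p))\<^sup>2 \<partial>(M \<Otimes>\<^sub>M M)) = (\<integral>p. \<integral>q. (u p - u q)\<^sup>2 \<partial>M \<partial>M)"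
    using P.integral_fst[OF int] by (simp add: case_prod_unfold)
  also have "\<dots> = (\<integral>p. (u p)\<^sup>2 - 2 * u p * (\<integral>q. u q \<partial>M) + (\<integral>q. (u q)\<^sup>2 \<partial>M) \<partial>M)"
    using i by (simp add: power2_diff prob_space)
  also have "\<dots> = 2 * (\<integral>p. (u p)\<^sup>2 \<partial>M) - 2 * (\<integral>p. u p \<partial>M)\<^sup>2"
    using i by (simp add: prob_space power2_eq_square)
  finally show ?thesis .
qed

text \<open>Exchanging the two variables reverses the sign of the kernel. Thus the first-order term,
  half of the kernel times \<open>u (fst p) - u (snd p)\<close>, integrates to \<open>u\<close>
  tested against the truncated transform. Truncation bounds the kernel, so that the two halves may
  be integrated separately.\<close>

lemma integral_cot_kernel_antisymmetric:
  assumes \<mu>: "circle_prob \<mu>"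
    and a: "a \<in> borel_measurable unit_interval"
    and law: "distr unit_interval circle_borel (\<lambda>p. cis (a p)) = \<mu>"
    and u [measurable]: "u \<in> borel_measurable unit_interval"
    and bound: "\<And>p. p \<in> {0<..<1} \<Longrightarrow> \<bar>u p\<bar> \<le> C"
    and e: "cos \<epsilon> < 1"
  shows "integrable (unit_interval \<Otimes>\<^sub>M unit_interval)
        (\<lambda>p. cot_kernel \<epsilon> (cis (a (fst p) - a (snd p))) * u (fst p))" (is ?i1)
    and "integrable (unit_interval \<Otimes>\<^sub>M unit_interval)
        (\<lambda>p. cot_kernel \<epsilon> (cis (a (fst p) - a (snd p))) * u (snd p))" (is ?i2)
    and "(\<integral>p. cot_kernel \<epsilon> (cis (a (fst p) - a (snd p))) * u (fst p) \<partial>(unit_interval \<Otimes>\<^sub>M unit_interval)) =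
      (\<integral>p. u p * truncated_hilbert \<mu> \<epsilon> (cis (a p)) \<partial>unit_interval)" (is ?eq1)
    and "(\<integral>p. cot_kernel \<epsilon> (cis (a (fst p) - a (snd p))) * u (snd p) \<partial>(unit_interval \<Otimes>\<^sub>M unit_interval)) =
      - (\<integral>p. u p * truncated_hilbert \<mu> \<epsilon> (cis (a p)) \<partial>unit_interval)" (is ?eq2)
proof -
  interpret prob_space unit_interval by (rule prob_space_unit_interval)
  interpret P: pair_prob_space unit_interval unit_interval ..
  let ?K = "\<lambda>p q. cot_kernel \<epsilon> (cis (a p - a q))"
  note [measurable] = a
  have cis_meas [measurable]: "cis \<in> borel_measurable borel"
    by (intro borel_measurable_continuous_onI continuous_intros)
  have K: "\<bar>?K p q\<bar> \<le> 1 / (1 - cos \<epsilon>)" for p q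
    by (rule abs_cot_kernel_le[OF _ e]) simp
  have C: "\<bar>?K p q * u r\<bar> \<le> 1 / (1 - cos \<epsilon>) * C" if "r \<in> {0<..<1}" for p q r
    unfolding abs_mult using K bound[OF that] e by (intro mult_mono) auto
  show i1: ?i1
    using C by (intro P.P.integrable_const_bound[where B = "1 / (1 - cos \<epsilon>) * C"] AE_I2)
      (auto simp: space_pair_measure space_restrict_space)
  show i2: ?i2
    using C by (intro P.P.integrable_const_bound[where B = "1 / (1 - cos \<epsilon>) * C"] AE_I2)
      (auto simp: space_pair_measure space_restrict_space)
  have "(\<integral>p. ?K (fst p) (snd p) * u (fst p) \<partial>(unit_interval \<Otimes>\<^sub>M unit_interval)) =
      (\<integral>p. \<integral>q. ?K p q * u p \<partial>unit_interval \<partial>unit_interval)"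
    using P.integral_fst'[OF i1] by simp
  also have "\<dots> = (\<integral>p. u p * truncated_hilbert \<mu> \<epsilon> (cis (a p)) \<partial>unit_interval)"
  proof (rule Bochner_Integration.integral_cong[OF refl])
    fix p
    have "(\<lambda>q. cot_kernel \<epsilon> (cis (a p) * cnj q)) \<in> borel_measurable borel"
      using measurable_compose[OF _ cot_kernel_mult_cnj_measurable, of "\<lambda>q. (cis (a p), q)" borel] by simp
    then have "(\<lambda>q. cot_kernel \<epsilon> (cis (a p) * cnj q)) \<in> borel_measurable circle_borel"
      by (rule measurable_restrict_space1)
    from circle_pushforward_integral(2)[OF a law this]
    have "(\<integral>q. ?K p q \<partial>unit_interval) = truncated_hilbert \<mu> \<epsilon> (cis (a p))"
      by (simp add: truncated_hilbert_def cot_kernel_cis_diff)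
    then show "(\<integral>q. ?K p q * u p \<partial>unit_interval) = u p * truncated_hilbert \<mu> \<epsilon> (cis (a p))"
      by simp
  qed
  finally show eq1: ?eq1 .
  have anti: "?K q p = - ?K p q" for p q
    using cot_kernel_cnj[of \<epsilon> "cis (a p - a q)"] by (simp add: cis_cnj)
  have "(\<integral>p. ?K (fst p) (snd p) * u (fst p) \<partial>(unit_interval \<Otimes>\<^sub>M unit_interval)) =
     (\<integral>p. ?K (snd p) (fst p) * u (snd p) \<partial>(unit_interval \<Otimes>\<^sub>M unit_interval))"
    using P.integral_product_swap[of "\<lambda>p. ?K (fst p) (snd p) * u (fst p)"] i1
    by (simp add: case_prod_unfold)
  also have "\<dots> = (\<integral>p. - (?K (fst p) (snd p) * u (snd p)) \<partial>(unit_interval \<Otimes>\<^sub>M unit_interval))"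
    by (intro Bochner_Integration.integral_cong refl) (simp add: anti[of "snd _" "fst _"])
  finally show ?eq2
    using eq1 by simp
qed

section \<open>Passing to the limit along a sequence of truncations\<close>

lemma truncation_sequence:
  fixes S :: "nat \<Rightarrow> real"
  defines "S \<equiv> \<lambda>n. 1 / real (Suc n)"
  shows "0 < S n" "S n < pi" "cos (S n) < 1" "S \<longlonglongrightarrow> 0" "filterlim S (at_right 0) sequentially"
proof -
  show pos: "0 < S n" for n by (simp add: S_def)
  have "S n \<le> 1" by (simp add: S_def)
  then show "S n < pi" using pi_gt3 by linarith
  with pos show "cos (S n) < 1" by (rule cos_less_1)
  show lim: "S \<longlonglongrightarrow> 0"
    unfolding S_def by (rule LIMSEQ_Suc[OF lim_1_over_n])
  show "filterlim S (at_right 0) sequentially"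
    unfolding filterlim_at using pos lim by (auto simp: less_imp_neq[symmetric] intro!: always_eventually)
qed

lemma circle_hilbert_measurable_bounded:
  assumes \<mu>: "circle_prob \<mu>" and sm: "smooth_circle_measure \<mu>"
  shows "circle_hilbert \<mu> \<in> borel_measurable circle_borel"
    and "\<exists>C\<ge>0. (\<forall>\<epsilon>. \<forall>z\<in>unit_circle. cos \<epsilon> < 1 \<longrightarrow> \<bar>truncated_hilbert \<mu> \<epsilon> z\<bar> \<le> C) \<and>
      (\<forall>z\<in>unit_circle. \<bar>circle_hilbert \<mu> z\<bar> \<le> C)"
proof -
  define S where "S n = 1 / real (Suc n)" for n
  note S = truncation_sequence[folded S_def]
  have lim: "(\<lambda>n. truncated_hilbert \<mu> (S n) z) \<longlonglongrightarrow> circle_hilbert \<mu> z" if "z \<in> unit_circle" for z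
    using filterlim_compose[OF truncated_hilbert_tendsto[OF sm that] S(5)] .
  have m: "truncated_hilbert \<mu> (S n) \<in> borel_measurable circle_borel" for n
    using truncated_hilbert_measurable[OF \<mu>, of "S n"] \<mu>
    by (simp add: circle_prob_def cong: measurable_cong_sets)
  show "circle_hilbert \<mu> \<in> borel_measurable circle_borel"
    by (rule borel_measurable_LIMSEQ_real[OF lim m]) (simp add: space_restrict_space)
  obtain m where "smooth_density \<mu> m"
    using sm by (auto simp: smooth_circle_measure_def)
  then obtain C where C: "0 \<le> C"
    "\<And>\<epsilon> z. cos \<epsilon> < 1 \<Longrightarrow> z \<in> unit_circle \<Longrightarrow> \<bar>truncated_hilbert \<mu> \<epsilon> z\<bar> \<le> C"
    using truncated_hilbert_bounded by blast
  have "\<bar>circle_hilbert \<mu> z\<bar> \<le> C" if z: "z \<in> unit_circle" for z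
    by (rule LIMSEQ_le_const2[OF tendsto_rabs[OF lim[OF z]]]) (use C(2)[OF S(3) z] in blast)
  with C show "\<exists>C\<ge>0. (\<forall>\<epsilon>. \<forall>z\<in>unit_circle. cos \<epsilon> < 1 \<longrightarrow> \<bar>truncated_hilbert \<mu> \<epsilon> z\<bar> \<le> C) \<and>
      (\<forall>z\<in>unit_circle. \<bar>circle_hilbert \<mu> z\<bar> \<le> C)"
    by blast
qed

lemma integral_truncated_hilbert_tendsto:
  assumes \<mu>: "circle_prob \<mu>" and sm: "smooth_circle_measure \<mu>"
    and a: "a \<in> borel_measurable unit_interval"
    and law: "distr unit_interval circle_borel (\<lambda>p. cis (a p)) = \<mu>"
    and u [measurable]: "u \<in> borel_measurable unit_interval"
    and bound: "\<And>p. p \<in> {0<..<1} \<Longrightarrow> \<bar>u p\<bar> \<le> B"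
  shows "(\<lambda>n. \<integral>p. u p * truncated_hilbert \<mu> (1 / real (Suc n)) (cis (a p)) \<partial>unit_interval)
    \<longlonglongrightarrow> (\<integral>p. u p * circle_hilbert \<mu> (cis (a p)) \<partial>unit_interval)"
proof -
  interpret prob_space unit_interval by (rule prob_space_unit_interval)
  note S = truncation_sequence
  obtain C where C: "0 \<le> C"
    "\<And>\<epsilon> z. z \<in> unit_circle \<Longrightarrow> cos \<epsilon> < 1 \<Longrightarrow> \<bar>truncated_hilbert \<mu> \<epsilon> z\<bar> \<le> C"
    using circle_hilbert_measurable_bounded(2)[OF \<mu> sm] by blast
  have [measurable]: "(\<lambda>p. circle_hilbert \<mu> (cis (a p))) \<in> borel_measurable unit_interval"
    by (rule circle_pushforward_integral(1)[OF a law circle_hilbert_measurable_bounded(1)[OF \<mu> sm]])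
  have [measurable]: "(\<lambda>p. truncated_hilbert \<mu> \<epsilon> (cis (a p))) \<in> borel_measurable unit_interval" for \<epsilon>
    using truncated_hilbert_measurable[OF \<mu>, of \<epsilon>] \<mu>
    by (intro circle_pushforward_integral(1)[OF a law]) (simp add: circle_prob_def cong: measurable_cong_sets)
  show ?thesis
  proof (rule integral_dominated_convergence[where w = "\<lambda>_. B * C"])
    show "AE p in unit_interval. (\<lambda>n. u p * truncated_hilbert \<mu> (1 / real (Suc n)) (cis (a p)))
        \<longlonglongrightarrow> u p * circle_hilbert \<mu> (cis (a p))"
      by (intro AE_I2 tendsto_mult tendsto_const filterlim_compose[OF truncated_hilbert_tendsto[OF sm] S(5)]) simp
    show "AE p in unit_interval. norm (u p * truncated_hilbert \<mu> (1 / real (Suc n)) (cis (a p))) \<le> B * C" for n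
      using bound C(2)[OF _ S(3)]
      by (intro AE_I2) (force simp: abs_mult space_restrict_space intro!: mult_mono order.trans[OF abs_ge_zero])
  qed simp_all
qed

text \<open>For \<open>u = 1\<close> the two formulas of
  \<open>integral_cot_kernel_antisymmetric\<close> describe the same integral with opposite signs.
  Mean zero is what makes adding a constant to H\<mu> - Q' cost nothing beyond the square in
  \<open>circle_fisher\<close>.\<close>

lemma integral_circle_hilbert:
  assumes \<mu>: "circle_prob \<mu>" and sm: "smooth_circle_measure \<mu>"
    and a: "a \<in> borel_measurable unit_interval"
    and law: "distr unit_interval circle_borel (\<lambda>p. cis (a p)) = \<mu>"
  shows "(\<integral>p. circle_hilbert \<mu> (cis (a p)) \<partial>unit_interval) = 0"
proof -
  have "(\<integral>p. truncated_hilbert \<mu> (1 / real (Suc n)) (cis (a p)) \<partial>unit_interval) = 0" for n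
    using integral_cot_kernel_antisymmetric(3,4)[OF \<mu> a law, of "\<lambda>_. 1" 1, OF _ _ truncation_sequence(3)[of n]]
    by simp
  with integral_truncated_hilbert_tendsto[OF \<mu> sm a law, of "\<lambda>_. 1" 1] show ?thesis
    by (simp add: LIMSEQ_const_iff)
qed

text \<open>\<open>pair_log_inequality\<close> is integrated over all pairs of parameters. The
  cotangent term has no integrable bound at hand near the diagonal, so the whole pointwise
  inequality is first multiplied by a cutoff; the logarithms and the squares are integrable and
  survive the limit, and the first-order term converges through the Hilbert transform.\<close>

lemma monotone_coupling_log_energy:
  fixes a b :: "real \<Rightarrow> real"
  assumes \<mu>: "circle_prob \<mu>" "smooth_circle_measure \<mu>" and \<nu>: "circle_prob \<nu>" "finite_log_energy \<nu>"
    and a: "mono_on {0<..<1} a" "a \<in> borel_measurable unit_interval"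
      "distr unit_interval circle_borel (\<lambda>p. cis (a p)) = \<mu>"
      "\<And>p. p \<in> {0<..<1} \<Longrightarrow> a p \<in> {c..c + 2 * pi}"
    and b: "mono_on {0<..<1} b" "b \<in> borel_measurable unit_interval"
      "distr unit_interval circle_borel (\<lambda>p. cis (b p)) = \<nu>"
      "\<And>p. p \<in> {0<..<1} \<Longrightarrow> b p \<in> {d..d + 2 * pi}"
  defines "u \<equiv> \<lambda>p. b p - a p"
  shows "(\<integral>p. ln (norm (fst p - snd p)) \<partial>(\<nu> \<Otimes>\<^sub>M \<nu>)) \<le>
    (\<integral>p. ln (norm (fst p - snd p)) \<partial>(\<mu> \<Otimes>\<^sub>M \<mu>)) +
    (\<integral>p. u p * circle_hilbert \<mu> (cis (a p)) \<partial>unit_interval) -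
    (\<integral>p. (u p)\<^sup>2 \<partial>unit_interval) / 4 + (\<integral>p. u p \<partial>unit_interval)\<^sup>2 / 4"
proof -
  interpret prob_space unit_interval by (rule prob_space_unit_interval)
  interpret P: pair_prob_space unit_interval unit_interval ..
  let ?UU = "unit_interval \<Otimes>\<^sub>M unit_interval"
  define S where "S n = 1 / real (Suc n)" for n
  note S = truncation_sequence[folded S_def]
  note [measurable] = a(2) b(2)
  have [measurable]: "cis \<in> borel_measurable borel"
    by (intro borel_measurable_continuous_onI continuous_intros)
  have u [measurable]: "u \<in> borel_measurable unit_interval"
    by (simp add: u_def)
  obtain m where "smooth_density \<mu> m"
    using \<mu>(2) by (auto simp: smooth_circle_measure_def)
  then have fin\<mu>: "finite_log_energy \<mu>"
    by (rule finite_log_energy_smooth[OF \<mu>(1)])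
  define lA where "lA p = ln (norm (cis (a (fst p)) - cis (a (snd p))))" for p
  define lB where "lB p = ln (norm (cis (b (fst p)) - cis (b (snd p))))" for p
  define K where "K n p = cot_kernel (S n) (cis (a (fst p) - a (snd p)))" for n and p :: "real \<times> real"
  \<comment> \<open>The indicator of the pairs on which the truncated kernel is active, so that
    \<open>K n\<close> is the cotangent times \<open>D n\<close>. Being nonnegative, it can multiply
    the inequality.\<close>
  define D where "D n p = (if cos (a (fst p) - a (snd p)) < cos (S n) then 1 else 0 :: real)" for n and p :: "real \<times> real"
  define q where "q p = (u (fst p) - u (snd p))\<^sup>2" for p :: "real \<times> real"
  note A = circle_pushforward_pair[OF \<mu>(1) fin\<mu> a(2,3), folded lA_def]
  note B = circle_pushforward_pair[OF \<nu> b(2,3), folded lB_def]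
  have D_meas [measurable]: "D n \<in> borel_measurable ?UU" for n
    unfolding D_def by measurable
  have q_meas [measurable]: "q \<in> borel_measurable ?UU"
    unfolding q_def by measurable
  have lA_meas [measurable]: "lA \<in> borel_measurable ?UU" and lB_meas [measurable]: "lB \<in> borel_measurable ?UU"
    using A(2) B(2) by auto
  have AE_space: "AE p in ?UU. fst p \<in> {0<..<1} \<and> snd p \<in> {0<..<1}"
    by (intro AE_I2) (auto simp: space_pair_measure space_restrict_space)
  define M where "M = \<bar>c\<bar> + \<bar>d\<bar> + 2 * pi"
  have ub: "\<bar>u p\<bar> \<le> M" if "p \<in> {0<..<1}" for p
    using a(4)[OF that] b(4)[OF that] by (auto simp: u_def M_def)
  have q_bound: "AE p in ?UU. \<bar>q p\<bar> \<le> (2 * M)\<^sup>2"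
    using AE_space
  proof eventually_elim
    fix p :: "real \<times> real" assume p: "fst p \<in> {0<..<1} \<and> snd p \<in> {0<..<1}"
    have "\<bar>u (fst p) - u (snd p)\<bar> \<le> 2 * M"
      using ub[of "fst p"] ub[of "snd p"] p by linarith
    then show "\<bar>q p\<bar> \<le> (2 * M)\<^sup>2"
      using abs_le_square_iff[of "u (fst p) - u (snd p)" "2 * M"] by (simp add: q_def)
  qed
  have q_int: "integrable ?UU q"
    using q_bound by (intro P.P.integrable_const_bound[where B = "(2 * M)\<^sup>2"]) auto
  have D_le: "\<bar>D n p\<bar> \<le> 1" for n p by (simp add: D_def)
  have D_int: "integrable ?UU (\<lambda>p. D n p * f p)" if "integrable ?UU f" for n f
    using that D_le[of n]
    by (intro Bochner_Integration.integrable_bound[OF that]) (auto simp: abs_mult intro!: mult_left_le_one_le)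
  \<comment> \<open>The cutoff disappears wherever the two points on the circle differ, which is
    almost everywhere by finite energy of \<mu>.\<close>
  have D_lim: "AE p in ?UU. (\<lambda>n. D n p) \<longlonglongrightarrow> 1"
    using A(1)
  proof eventually_elim
    fix p :: "real \<times> real" assume p: "cis (a (fst p)) \<noteq> cis (a (snd p))"
    have "cos (a (fst p) - a (snd p)) \<noteq> 1"
    proof
      assume 1: "cos (a (fst p) - a (snd p)) = 1"
      then have "sin (a (fst p) - a (snd p)) = 0"
        using sin_cos_squared_add[of "a (fst p) - a (snd p)"] by simp
      with 1 have "cis (a (fst p) - a (snd p)) = 1"
        by (simp add: complex_eq_iff)
      with p show False
        by (simp add: cis_divide[symmetric])
    qed
    then have "cos (a (fst p) - a (snd p)) < cos 0"
      using cos_le_one[of "a (fst p) - a (snd p)"] by (simp add: order.strict_iff_order)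
    moreover have "(\<lambda>n. cos (S n)) \<longlonglongrightarrow> cos 0"
      using S(4) by (rule tendsto_cos)
    ultimately have "eventually (\<lambda>n. cos (a (fst p) - a (snd p)) < cos (S n)) sequentially"
      using order_tendstoD(1) by blast
    then have "eventually (\<lambda>n. D n p = 1) sequentially"
      by eventually_elim (simp add: D_def)
    then show "(\<lambda>n. D n p) \<longlonglongrightarrow> 1"
      by (simp add: tendsto_eventually)
  qed
  have D_conv: "(\<lambda>n. \<integral>p. D n p * f p \<partial>?UU) \<longlonglongrightarrow> (\<integral>p. f p \<partial>?UU)" if f: "integrable ?UU f" for f
  proof (rule integral_dominated_convergence[where w = "\<lambda>p. \<bar>f p\<bar>"])
    show "AE p in ?UU. (\<lambda>n. D n p * f p) \<longlonglongrightarrow> f p"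
      using D_lim by eventually_elim (use tendsto_mult[OF _ tendsto_const] in fastforce)
    show "AE p in ?UU. norm (D n p * f p) \<le> \<bar>f p\<bar>" for n
      using D_le[of n] by (intro AE_I2) (auto simp: abs_mult intro!: mult_left_le_one_le)
  qed (use f in auto)
  note anti = integral_cot_kernel_antisymmetric[OF \<mu>(1) a(2,3) u ub S(3), folded K_def]
  have step: "(\<integral>p. D n p * lB p \<partial>?UU) \<le> (\<integral>p. D n p * lA p \<partial>?UU) +
     (\<integral>p. u p * truncated_hilbert \<mu> (S n) (cis (a p)) \<partial>unit_interval) - (\<integral>p. D n p * q p \<partial>?UU) / 8" for n
  proof -
    have "AE p in ?UU. D n p * lB p \<le> D n p * lA p + (K n p * u (fst p) - K n p * u (snd p)) / 2 - D n p * q p / 8"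
      using A(1) B(1) AE_space
    proof eventually_elim
      fix p :: "real \<times> real" assume neA: "cis (a (fst p)) \<noteq> cis (a (snd p))" and neB: "cis (b (fst p)) \<noteq> cis (b (snd p))"
        and p: "fst p \<in> {0<..<1} \<and> snd p \<in> {0<..<1}"
      define x y where "x = a (fst p) - a (snd p)" and "y = b (fst p) - b (snd p)"
      have lA: "lA p = ln (2 * \<bar>sin (x / 2)\<bar>)" and lB: "lB p = ln (2 * \<bar>sin (y / 2)\<bar>)"
        by (simp_all add: lA_def lB_def norm_cis_diff x_def y_def)
      have "norm (cis (a (fst p)) - cis (a (snd p))) \<noteq> 0" "norm (cis (b (fst p)) - cis (b (snd p))) \<noteq> 0"
        using neA neB by auto
      then have nz: "sin (x / 2) \<noteq> 0" "sin (y / 2) \<noteq> 0"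
        unfolding norm_cis_diff by (auto simp: x_def y_def)
      have "\<bar>x\<bar> \<le> 2 * pi" "\<bar>y\<bar> \<le> 2 * pi"
        using a(4)[of "fst p"] a(4)[of "snd p"] b(4)[of "fst p"] b(4)[of "snd p"] p
        by (auto simp: x_def y_def abs_le_iff)
      \<comment> \<open>The one place where monotonicity of the coupling acts: both differences
        follow the order of the parameters.\<close>
      moreover have "0 \<le> x \<and> 0 \<le> y \<or> x \<le> 0 \<and> y \<le> 0"
        using mono_onD[OF a(1), of "fst p" "snd p"] mono_onD[OF a(1), of "snd p" "fst p"]
          mono_onD[OF b(1), of "fst p" "snd p"] mono_onD[OF b(1), of "snd p" "fst p"] p
        by (cases "fst p \<le> snd p") (auto simp: x_def y_def)
      ultimately have "lB p \<le> lA p + cot (x / 2) * (y - x) / 2 - (y - x)\<^sup>2 / 8"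
        unfolding lA lB using nz by (rule pair_log_inequality)
      moreover have "y - x = u (fst p) - u (snd p)"
        by (simp add: x_def y_def u_def)
      ultimately have ineq: "lB p \<le> lA p + cot (x / 2) * (u (fst p) - u (snd p)) / 2 - q p / 8"
        by (simp add: q_def)
      have "K n p = D n p * cot (x / 2)"
        by (simp add: K_def D_def cot_kernel_cis x_def)
      with ineq show "D n p * lB p \<le> D n p * lA p + (K n p * u (fst p) - K n p * u (snd p)) / 2 - D n p * q p / 8"
        by (simp add: D_def algebra_simps)
    qed
    then have "(\<integral>p. D n p * lB p \<partial>?UU) \<le>
        (\<integral>p. D n p * lA p + (K n p * u (fst p) - K n p * u (snd p)) / 2 - D n p * q p / 8 \<partial>?UU)"
      using anti(1,2)[of n] D_int[OF A(2)] D_int[OF B(2)] D_int[OF q_int]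
      by (intro integral_mono_AE) auto
    also have "\<dots> = (\<integral>p. D n p * lA p \<partial>?UU) +
        ((\<integral>p. K n p * u (fst p) \<partial>?UU) - (\<integral>p. K n p * u (snd p) \<partial>?UU)) / 2 - (\<integral>p. D n p * q p \<partial>?UU) / 8"
      using anti(1,2)[of n] D_int[OF A(2)] D_int[OF q_int] by simp
    finally show ?thesis
      using anti(3,4)[of n] by simp
  qed
  have lim_u: "(\<lambda>n. \<integral>p. u p * truncated_hilbert \<mu> (S n) (cis (a p)) \<partial>unit_interval)
      \<longlonglongrightarrow> (\<integral>p. u p * circle_hilbert \<mu> (cis (a p)) \<partial>unit_interval)"
    unfolding S_def by (rule integral_truncated_hilbert_tendsto[OF \<mu> a(2,3) u ub])
  have "(\<integral>p. lB p \<partial>?UU) \<le> (\<integral>p. lA p \<partial>?UU) +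
     (\<integral>p. u p * circle_hilbert \<mu> (cis (a p)) \<partial>unit_interval) - (\<integral>p. q p \<partial>?UU) / 8"
    using step
    by (intro LIMSEQ_le[OF D_conv[OF B(2)]
          tendsto_diff[OF tendsto_add[OF D_conv[OF A(2)] lim_u] tendsto_divide[OF D_conv[OF q_int] tendsto_const]]])
       auto
  \<comment> \<open>The factor 2 turns the weight 1/8 per pair into the 1/4 of the
    statement.\<close>
  moreover have "(\<integral>p. q p \<partial>?UU) = 2 * (\<integral>p. (u p)\<^sup>2 \<partial>unit_interval) - 2 * (\<integral>p. u p \<partial>unit_interval)\<^sup>2"
    unfolding q_def
    by (rule integral_pair_difference_square[OF prob_space_unit_interval u, of M]) (use ub in \<open>simp add: space_restrict_space\<close>)
  ultimately show ?thesis
    using A(3) B(3) by linarith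
qed

section \<open>The logarithmic Sobolev inequality\<close>

theorem theorem7:
  fixes Q :: "complex \<Rightarrow> real" and \<rho> :: real and \<mu>\<^sub>Q \<mu> :: "complex measure"
  assumes "circle_Ck 3 Q"
    and "\<rho> > 0"
    and "\<forall>z\<in>unit_circle. (circle_deriv ^^ 2) Q z \<ge> \<rho> - 1 / 2"
    and "energy_minimizer Q \<mu>\<^sub>Q"
    and "circle_prob \<mu>"
    and "smooth_circle_measure \<mu>"
  shows "log_energy Q \<mu> - log_energy Q \<mu>\<^sub>Q \<le> ereal (1 / (2 * \<rho>) * circle_fisher Q \<mu>)"
proof -
  note \<mu> = assms(5,6)
  obtain m where "smooth_density \<mu> m"
    using \<mu>(2) by (auto simp: smooth_circle_measure_def)
  then have fin\<mu>: "finite_log_energy \<mu>"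
    by (rule finite_log_energy_smooth[OF \<mu>(1)])
  note E\<mu> = finite_log_energy_facts(3)[OF \<mu>(1) fin\<mu>, of Q]
  have \<nu>: "circle_prob \<mu>\<^sub>Q"
    using assms(4) by (simp add: energy_minimizer_def)
  show ?thesis
  proof (cases "finite_log_energy \<mu>\<^sub>Q")
    \<comment> \<open>Here the left-hand side is a real number minus \<open>\<infinity>\<close>,
      hence \<open>- \<infinity>\<close>.\<close>
    case False
    then show ?thesis
      using log_energy_infinite[OF \<nu>, of Q] E\<mu> by simp
  next
    case True
    note E\<nu> = finite_log_energy_facts(3)[OF \<nu> True, of Q]
    interpret prob_space unit_interval by (rule prob_space_unit_interval)
    obtain a where a: "mono_on {0<..<1} a" "a \<in> borel_measurable unit_interval"
      "distr unit_interval circle_borel (\<lambda>p. cis (a p)) = \<mu>"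
      "\<And>p. p \<in> {0<..<1} \<Longrightarrow> a p \<in> {-pi..-pi + 2 * pi}"
      using circle_quantile_function[OF \<mu>(1) Arg_borel_measurable, of "-pi" "-pi + 2 * pi"]
        cis_Arg_circle Arg_bounded by (smt (verit, best))
    \<comment> \<open>Prescribing for \<open>b\<close> the mean of \<open>a\<close> makes the
      displacement have mean zero.\<close>
    obtain b d where b: "mono_on {0<..<1} b" "b \<in> borel_measurable unit_interval"
      "distr unit_interval circle_borel (\<lambda>p. cis (b p)) = \<mu>\<^sub>Q"
      "\<And>p. p \<in> {0<..<1} \<Longrightarrow> b p \<in> {d..d + 2 * pi}"
      and mean: "expectation b = expectation a"
      using circle_quantile_function_with_mean[OF \<nu> True, of "expectation a"] by blast
    define u where "u p = b p - a p" for p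
    define h where "h p = circle_hilbert \<mu> (cis (a p))" for p
    define g where "g p = circle_deriv Q (cis (a p))" for p
    note [measurable] = a(2) b(2)
    have u_meas [measurable]: "u \<in> borel_measurable unit_interval"
      unfolding u_def by measurable

    have d0: "((\<lambda>t. Q (cis t)) has_real_derivative circle_deriv Q (cis t)) (at t)" for t
      using circle_Ck_has_derivative[OF assms(1), of 0] by simp
    have d1: "((\<lambda>t. circle_deriv Q (cis t)) has_real_derivative (circle_deriv ^^ 2) Q (cis t)) (at t)" for t
      using circle_Ck_has_derivative[OF assms(1), of 1] by (simp add: numeral_2_eq_2)
    have "continuous_on UNIV (\<lambda>t. Q (cis t))" "continuous_on UNIV (\<lambda>t. circle_deriv Q (cis t))"
      using d0 d1 by (meson DERIV_continuous_on has_field_derivative_at_within)+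
    note QC = this(1)[THEN circle_function_measurable_bounded(1)] this(1)[THEN circle_function_measurable_bounded(2)]
      and Q'C = this(2)[THEN circle_function_measurable_bounded(1)] this(2)[THEN circle_function_measurable_bounded(2)]
    have HC: "circle_hilbert \<mu> \<in> borel_measurable circle_borel" "\<exists>C\<ge>0. \<forall>z\<in>unit_circle. \<bar>circle_hilbert \<mu> z\<bar> \<le> C"
      using circle_hilbert_measurable_bounded[OF \<mu>] by blast+
    note push_a = circle_pushforward_integral[OF a(2,3)] and push_b = circle_pushforward_integral[OF b(2,3)]
    obtain CQ Cg Ch where C: "\<And>z. z \<in> unit_circle \<Longrightarrow> \<bar>Q z\<bar> \<le> CQ"
      "\<And>p. \<bar>g p\<bar> \<le> Cg" "\<And>p. \<bar>h p\<bar> \<le> Ch"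
      using QC(2) Q'C(2) HC(2) unfolding g_def h_def by (metis norm_cis dist_0_norm mem_sphere)
    have g_meas [measurable]: "g \<in> borel_measurable unit_interval" and h_meas [measurable]: "h \<in> borel_measurable unit_interval"
      and Qa_meas [measurable]: "(\<lambda>p. Q (cis (a p))) \<in> borel_measurable unit_interval"
      and Qb_meas [measurable]: "(\<lambda>p. Q (cis (b p))) \<in> borel_measurable unit_interval"
      unfolding g_def h_def using push_a(1)[OF QC(1)] push_b(1)[OF QC(1)] push_a(1)[OF Q'C(1)] push_a(1)[OF HC(1)] by auto
    define Cu where "Cu = 4 * pi + \<bar>d\<bar>"
    have Cu: "\<bar>u p\<bar> \<le> Cu" if "p \<in> {0<..<1}" for p
      using a(4)[OF that] b(4)[OF that] by (auto simp: u_def Cu_def)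
    have bounded_int: "integrable unit_interval f"
      if "f \<in> borel_measurable unit_interval" "\<And>p. p \<in> {0<..<1} \<Longrightarrow> \<bar>f p\<bar> \<le> B" for f :: "real \<Rightarrow> real" and B
      using that by (intro integrable_const_bound[where B = B] AE_I2) (auto simp: space_restrict_space)
    have prod_int: "integrable unit_interval (\<lambda>p. f p * f' p)"
      if "f \<in> borel_measurable unit_interval" "\<And>p. p \<in> {0<..<1} \<Longrightarrow> \<bar>f p\<bar> \<le> B"
        "f' \<in> borel_measurable unit_interval" "\<And>p. p \<in> {0<..<1} \<Longrightarrow> \<bar>f' p\<bar> \<le> B'"
      for f f' :: "real \<Rightarrow> real" and B B'
    proof (rule bounded_int)
      fix p :: real assume "p \<in> {0<..<1}"
      with that(2,4) show "\<bar>f p * f' p\<bar> \<le> B * B'"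
        unfolding abs_mult by (intro mult_mono) (auto intro: order.trans[OF abs_ge_zero])
    qed (use that in measurable)
    have int: "integrable unit_interval a" "integrable unit_interval b"
      "integrable unit_interval u" "integrable unit_interval g" "integrable unit_interval h"
      "integrable unit_interval (\<lambda>p. Q (cis (a p)))" "integrable unit_interval (\<lambda>p. Q (cis (b p)))"
      "integrable unit_interval (\<lambda>p. u p * u p)" "integrable unit_interval (\<lambda>p. g p * u p)"
      "integrable unit_interval (\<lambda>p. u p * h p)" "integrable unit_interval (\<lambda>p. (h p - g p) * (h p - g p))"
    proof -
      have "\<bar>a p\<bar> \<le> pi" if "p \<in> {0<..<1}" for p
        using a(4)[OF that] by auto
      then show "integrable unit_interval a"
        by (intro bounded_int[of _ pi]) auto
      have "\<bar>b p\<bar> \<le> \<bar>d\<bar> + 2 * pi" if "p \<in> {0<..<1}" for p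
        using b(4)[OF that] by auto
      then show "integrable unit_interval b"
        by (intro bounded_int[of _ "\<bar>d\<bar> + 2 * pi"]) auto
      show "integrable unit_interval u" "integrable unit_interval g" "integrable unit_interval h"
        using bounded_int[OF u_meas Cu] bounded_int[OF g_meas C(2)] bounded_int[OF h_meas C(3)] by auto
      show "integrable unit_interval (\<lambda>p. Q (cis (a p)))" "integrable unit_interval (\<lambda>p. Q (cis (b p)))"
        using bounded_int[OF Qa_meas C(1)] bounded_int[OF Qb_meas C(1)] by auto
      show "integrable unit_interval (\<lambda>p. u p * u p)" "integrable unit_interval (\<lambda>p. g p * u p)"
        "integrable unit_interval (\<lambda>p. u p * h p)"
        using prod_int[OF u_meas Cu u_meas Cu] prod_int[OF g_meas C(2) u_meas Cu] prod_int[OF u_meas Cu h_meas C(3)]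
        by auto
      have hg: "(\<lambda>p. h p - g p) \<in> borel_measurable unit_interval"
        by measurable
      have hg_le: "\<bar>h p - g p\<bar> \<le> Ch + Cg" for p
        using C(2,3)[of p] by linarith
      show "integrable unit_interval (\<lambda>p. (h p - g p) * (h p - g p))"
        by (rule prod_int[OF hg hg_le hg hg_le])
    qed
    have u0: "expectation u = 0"
      unfolding u_def using int(1,2) mean by simp
    have h0: "expectation h = 0"
      unfolding h_def by (rule integral_circle_hilbert[OF \<mu> a(2,3)])
    define c where "c = expectation g"
    have c_eq: "(\<integral>z. circle_deriv Q z \<partial>\<mu>) = c"
      unfolding c_def g_def by (rule push_a(2)[OF Q'C(1), symmetric])
    have "(\<lambda>z. (circle_hilbert \<mu> z - circle_deriv Q z)\<^sup>2) \<in> borel_measurable circle_borel"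
      using HC(1) Q'C(1) by measurable
    from push_a(2)[OF this] have fisher: "circle_fisher Q \<mu> = expectation (\<lambda>p. (h p - g p) * (h p - g p)) - c\<^sup>2"
      unfolding circle_fisher_def c_eq by (simp add: h_def g_def power2_eq_square)

    \<comment> \<open>The expansion runs along the lift of \<open>Q\<close> to the line. The
      curvature bound holds at every angle, so the segment from \<open>a p\<close> to
      \<open>b p\<close> may wind around the circle.\<close>
    have "Q (cis (a p)) + g p * u p + (\<rho> - 1 / 2) / 2 * (u p * u p) \<le> Q (cis (b p))" for p
      using second_order_lower_bound[of "a p" "b p" "\<lambda>t. Q (cis t)" "\<lambda>t. circle_deriv Q (cis t)"
          "\<lambda>t. (circle_deriv ^^ 2) Q (cis t)" "\<rho> - 1 / 2", OF d0 d1] assms(3)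
      by (simp add: g_def u_def power2_eq_square)
    then have "expectation (\<lambda>p. Q (cis (a p)) + g p * u p + (\<rho> - 1 / 2) / 2 * (u p * u p)) \<le> expectation (\<lambda>p. Q (cis (b p)))"
      using int by (intro integral_mono) auto
    then have potential: "expectation (\<lambda>p. Q (cis (a p))) + expectation (\<lambda>p. g p * u p) +
        (\<rho> - 1 / 2) / 2 * expectation (\<lambda>p. u p * u p) \<le> expectation (\<lambda>p. Q (cis (b p)))"
      using int by simp
    have entropy: "(\<integral>p. ln (norm (fst p - snd p)) \<partial>(\<mu>\<^sub>Q \<Otimes>\<^sub>M \<mu>\<^sub>Q)) \<le>
      (\<integral>p. ln (norm (fst p - snd p)) \<partial>(\<mu> \<Otimes>\<^sub>M \<mu>)) +
      expectation (\<lambda>p. u p * h p) - expectation (\<lambda>p. u p * u p) / 4"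
      using monotone_coupling_log_energy[OF \<mu> \<nu> True a b] u0
      unfolding u_def h_def by (simp add: power2_eq_square)

    \<comment> \<open>The right side minus the left is the square of
      \<open>h p - g p + c - \<rho> * u p\<close> over \<open>2 * \<rho>\<close>. The term
      \<open>c * u p\<close> is inserted because it integrates to 0.\<close>
    have "(u p * h p - g p * u p) - \<rho> / 2 * (u p * u p) + c * u p \<le>
        1 / (2 * \<rho>) * ((h p - g p) * (h p - g p) + 2 * c * h p - 2 * c * g p + c\<^sup>2)" for p
    proof -
      have "0 \<le> (h p - g p + c - \<rho> * u p)\<^sup>2 / (2 * \<rho>)"
        using assms(2) by simp
      also have "\<dots> = 1 / (2 * \<rho>) * ((h p - g p) * (h p - g p) + 2 * c * h p - 2 * c * g p + c\<^sup>2)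
          - ((u p * h p - g p * u p) - \<rho> / 2 * (u p * u p) + c * u p)"
        using assms(2) by (simp add: field_simps power2_eq_square)
      finally show ?thesis by simp
    qed
    then have "expectation (\<lambda>p. (u p * h p - g p * u p) - \<rho> / 2 * (u p * u p) + c * u p) \<le>
        expectation (\<lambda>p. 1 / (2 * \<rho>) * ((h p - g p) * (h p - g p) + 2 * c * h p - 2 * c * g p + c\<^sup>2))"
      using int by (intro integral_mono Bochner_Integration.integrable_add Bochner_Integration.integrable_diff
          integrable_mult_right integrable_const) auto
    \<comment> \<open>Since \<open>h\<close> has mean 0 and \<open>g\<close> has mean
      \<open>c\<close>, the cross terms leave \<open>- 2 * c * c\<close>; with the added
      \<open>c\<^sup>2\<close> this is the subtracted square in
      \<open>circle_fisher\<close>.\<close>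
    then have "expectation (\<lambda>p. u p * h p) - expectation (\<lambda>p. g p * u p) - \<rho> / 2 * expectation (\<lambda>p. u p * u p)
        \<le> 1 / (2 * \<rho>) * (expectation (\<lambda>p. (h p - g p) * (h p - g p)) - 2 * c * c + c\<^sup>2)"
      using int u0 h0 prob_space by (simp add: c_def[symmetric])
    then have square: "expectation (\<lambda>p. u p * h p) - expectation (\<lambda>p. g p * u p) - \<rho> / 2 * expectation (\<lambda>p. u p * u p)
        \<le> 1 / (2 * \<rho>) * circle_fisher Q \<mu>"
      unfolding fisher by (simp add: power2_eq_square)
    \<comment> \<open>The deficit 1/4 of the potential cancels against the 1/4 gained from the
      interaction.\<close>
    have "(\<rho> - 1 / 2) / 2 * expectation (\<lambda>p. u p * u p) =
        \<rho> / 2 * expectation (\<lambda>p. u p * u p) - expectation (\<lambda>p. u p * u p) / 4"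
      by (simp add: field_simps)
    then have "((\<integral>z. Q z \<partial>\<mu>) - (\<integral>p. ln (norm (fst p - snd p)) \<partial>(\<mu> \<Otimes>\<^sub>M \<mu>))) -
      ((\<integral>z. Q z \<partial>\<mu>\<^sub>Q) - (\<integral>p. ln (norm (fst p - snd p)) \<partial>(\<mu>\<^sub>Q \<Otimes>\<^sub>M \<mu>\<^sub>Q)))
      \<le> 1 / (2 * \<rho>) * circle_fisher Q \<mu>"
      using potential entropy square push_a(2)[OF QC(1)] push_b(2)[OF QC(1)] by linarith
    then show ?thesis
      unfolding E\<mu> E\<nu> by simp
  qed
qed

end
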